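(* In the setting of the context, fix $t$ and a possible realization $m=(m^{(1)},\dots,m^{(t)})$ of the first $t$ merges of the randomized clustering algorithm, with $m^{(t)}=(C_1,C_2)$, and define $U,\mathcal{A}_\Sigma$ with respect to $(C_1,C_2)$. Define the p-value $\mathbf{P}^{(t)}_\Sigma(U;\mathcal{A}_\Sigma)=1-\mathbb{F}^{(t)}(U;\mathcal{A}_\Sigma,m)$. If $H_0^{(t)}:\bar\mu_{C_1}=\bar\mu_{C_2}$ holds, then for every $0\le\alpha\le1$, $$\mathbb{P}_{H_0^{(t)}}\big(\mathbf{P}^{(t)}_\Sigma(U;\mathcal{A}_\Sigma)\le\alpha\,\big|\,(M^{(1)},\dots,M^{(t)})=m\big)=\alpha.$$
   Context: Model: $X\sim\mathcal{MN}_{n\times p}(\mu,I_n,\Sigma)$ (independent rows $X_i\sim\mathcal{N}_p(\mu_i,\Sigma)$), $\Sigma$ known positive definite, $\bar\mu_C=|C|^{-1}\sum_{i\in C}\mu_i$. Randomized agglomerative clustering: start with singletons; at step $s$, $\mathcal{M}^{(s)}$ is the set of pairs of distinct current clusters, $d(M;x)\ge0$ a linkage dissimilarity; given $X=x$ the merge $M^{(s)}$ is drawn with probability $p^{(s)}(M;x)=\exp(-d(M;x)/\tau^{(s)})/\sum_{M'\in\mathcal{M}^{(s)}}\exp(-d(M';x)/\tau^{(s)})$, with $\tau^{(s)}=\tau\,|\mathcal{M}^{(s)}|^{-1}\sum_{M'\in\mathcal{M}^{(s)}}d(M';x)>0$, $\tau>0$ fixed; merged clusters replaced by their union; draws independent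 across steps given data; $p^{(s)}(m^{(s)};x)$ uses the candidate set determined by $m^{(1)},\dots,m^{(s-1)}$. $\nu_i=\mathbb{1}\{i\in C_1\}/|C_1|-\mathbb{1}\{i\in C_2\}/|C_2|$; $U=\|\Sigma^{-1/2}X^\top\nu\|_2$; $\mathcal{A}_\Sigma=(\xi,\pi)$ with $\xi=(\Sigma^{-1/2}X^\top\nu/\|\Sigma^{-1/2}X^\top\nu\|_2)^\top$, $\pi=(I_n-\nu\nu^\top/\|\nu\|_2^2)X$; $X(u;a)=u\,\nu\,\xi_a\Sigma^{1/2}/\|\nu\|_2^2+\pi_a$ for $a=(\xi_a,\pi_a)$; and $$\mathbb{F}^{(t)}(u;a,m)=\frac{\int_0^u \ell_{\|\nu\|_2\chi_p}(u')\prod_{s=1}^t p^{(s)}(m^{(s)};X(u';a))\,du'}{\int_0^\infty \ell_{\|\nu\|_2\chi_p}(u')\prod_{s=1}^t p^{(s)}(m^{(s)};X(u';a))\,du'},$$ $\ell_{\|\nu\|_2\chi_p}$ being the density of $\|\nu\|_2$ times a $\chi_p$ variable. *)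

theory Defs
  imports "HOL-Probability.Probability"
begin

section \<open>Matrices: data X :: real^'p^'n (rows = observations), \<Sigma> :: real^'p^'p\<close>

definition sym_mat :: "real^'p^'p \<Rightarrow> bool" where
  "sym_mat S \<longleftrightarrow> transpose S = S"

definition pos_def :: "real^'p^'p \<Rightarrow> bool" where
  "pos_def S \<longleftrightarrow> sym_mat S \<and> (\<forall>v. v \<noteq> 0 \<longrightarrow> v \<bullet> (S *v v) > 0)"

definition mat_sqrt :: "real^'p^'p \<Rightarrow> real^'p^'p" where
  "mat_sqrt S = (THE R. pos_def R \<and> R ** R = S)"

definition mat_isqrt :: "real^'p^'p \<Rightarrow> real^'p^'p" where
  "mat_isqrt S = matrix_inv (mat_sqrt S)"

section \<open>Matrix normal law MN(\<mu>, I_n, \<Sigma>): independent rows N_p(\<mu>_i, \<Sigma>)\<close>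

definition mn_density :: "real^'p^'n \<Rightarrow> real^'p^'p \<Rightarrow> real^'p^'n \<Rightarrow> real" where
  "mn_density \<mu> \<Sigma> x =
     (\<Prod>i\<in>UNIV. exp (- ((x $ i - \<mu> $ i) \<bullet> (matrix_inv \<Sigma> *v (x $ i - \<mu> $ i))) / 2)
                 / sqrt ((2 * pi) ^ CARD('p) * det \<Sigma>))"

definition matrix_normal :: "real^'p^'n \<Rightarrow> real^'p^'p \<Rightarrow> (real^'p^'n) measure" where
  "matrix_normal \<mu> \<Sigma> = density lborel (\<lambda>x. ennreal (mn_density \<mu> \<Sigma> x))"

text \<open>A merge is an unordered pair {A,B} of distinct current clusters; a merge history
  is the list [m^(1),...,m^(s)].\<close>

definition clusters_after :: "'n set set list \<Rightarrow> 'n set set" where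
  "clusters_after ms = foldl (\<lambda>C M. (C - M) \<union> {\<Union>M}) (range (\<lambda>i. {i})) ms"

definition cands :: "'n set set list \<Rightarrow> 'n set set set" where
  "cands ms = {{A, B} | A B. A \<in> clusters_after ms \<and> B \<in> clusters_after ms \<and> A \<noteq> B}"

definition temp :: "('n set set \<Rightarrow> real^'p^'n \<Rightarrow> real) \<Rightarrow> real \<Rightarrow> 'n set set list \<Rightarrow> real^'p^'n \<Rightarrow> real" where
  "temp d \<tau> ms x = \<tau> * (\<Sum>M'\<in>cands ms. d M' x) / real (card (cands ms))"

definition step_prob :: "('n set set \<Rightarrow> real^'p^'n \<Rightarrow> real) \<Rightarrow> real \<Rightarrow> 'n set set list \<Rightarrow> 'n set set \<Rightarrow> real^'p^'n \<Rightarrow> real" where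
  "step_prob d \<tau> ms M x =
     (if M \<in> cands ms then
        exp (- d M x / temp d \<tau> ms x) / (\<Sum>M'\<in>cands ms. exp (- d M' x / temp d \<tau> ms x))
      else 0)"

definition seq_prob :: "('n set set \<Rightarrow> real^'p^'n \<Rightarrow> real) \<Rightarrow> real \<Rightarrow> 'n set set list \<Rightarrow> real^'p^'n \<Rightarrow> real" where
  "seq_prob d \<tau> ms x = (\<Prod>s<length ms. step_prob d \<tau> (take s ms) (ms ! s) x)"

definition valid_history :: "'n set set list \<Rightarrow> bool" where
  "valid_history ms \<longleftrightarrow> (\<forall>s<length ms. ms ! s \<in> cands (take s ms))"

text \<open>Joint law of (X, (M^(1),...,M^(t))): X ~ MN(\<mu>, I_n, \<Sigma>), and given X = x the merge
  sequence has probability \<open>\<Prod>_s p^(s)(m^(s);x)\<close>.\<close>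
definition joint_law :: "real^'p^'n \<Rightarrow> real^'p^'p \<Rightarrow> ('n set set \<Rightarrow> real^'p^'n \<Rightarrow> real) \<Rightarrow> real \<Rightarrow> nat
     \<Rightarrow> ((real^'p^'n) \<times> 'n set set list) measure" where
  "joint_law \<mu> \<Sigma> d \<tau> t =
     density (matrix_normal \<mu> \<Sigma> \<Otimes>\<^sub>M count_space {ms. length ms = t})
             (\<lambda>(x, ms). ennreal (seq_prob d \<tau> ms x))"

definition contrast :: "'n set \<Rightarrow> 'n set \<Rightarrow> real^'n" where
  "contrast C1 C2 = (\<chi> i. (if i \<in> C1 then 1 / real (card C1) else 0)
                         - (if i \<in> C2 then 1 / real (card C2) else 0))"

definition stat_vec :: "real^'p^'p \<Rightarrow> real^'n \<Rightarrow> real^'p^'n \<Rightarrow> real^'p" where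
  "stat_vec \<Sigma> \<nu> x = mat_isqrt \<Sigma> *v (transpose x *v \<nu>)"

definition statU :: "real^'p^'p \<Rightarrow> real^'n \<Rightarrow> real^'p^'n \<Rightarrow> real" where
  "statU \<Sigma> \<nu> x = norm (stat_vec \<Sigma> \<nu> x)"

definition statXi :: "real^'p^'p \<Rightarrow> real^'n \<Rightarrow> real^'p^'n \<Rightarrow> real^'p" where
  "statXi \<Sigma> \<nu> x = (1 / norm (stat_vec \<Sigma> \<nu> x)) *\<^sub>R stat_vec \<Sigma> \<nu> x"

definition statPi :: "real^'n \<Rightarrow> real^'p^'n \<Rightarrow> real^'p^'n" where
  "statPi \<nu> x = (mat 1 - (\<chi> i j. \<nu> $ i * \<nu> $ j / (norm \<nu>)\<^sup>2)) ** x"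

definition ancillary :: "real^'p^'p \<Rightarrow> real^'n \<Rightarrow> real^'p^'n \<Rightarrow> (real^'p) \<times> (real^'p^'n)" where
  "ancillary \<Sigma> \<nu> x = (statXi \<Sigma> \<nu> x, statPi \<nu> x)"

definition recon :: "real^'p^'p \<Rightarrow> real^'n \<Rightarrow> real \<Rightarrow> (real^'p) \<times> (real^'p^'n) \<Rightarrow> real^'p^'n" where
  "recon \<Sigma> \<nu> u a =
     (\<chi> i j. u * \<nu> $ i * ((fst a v* mat_sqrt \<Sigma>) $ j) / (norm \<nu>)\<^sup>2) + snd a"

definition chi_density :: "nat \<Rightarrow> real \<Rightarrow> real" where
  "chi_density k u = (if u > 0 then u ^ (k - 1) * exp (- u\<^sup>2 / 2)
                        / (2 powr (real k / 2 - 1) * Gamma (real k / 2)) else 0)"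

definition scaled_chi_density :: "real \<Rightarrow> nat \<Rightarrow> real \<Rightarrow> real" where
  "scaled_chi_density c k u = chi_density k (u / c) / c"

definition selCDF :: "real^'p^'p \<Rightarrow> ('n set set \<Rightarrow> real^'p^'n \<Rightarrow> real) \<Rightarrow> real \<Rightarrow> real^'n
     \<Rightarrow> 'n set set list \<Rightarrow> real \<Rightarrow> (real^'p) \<times> (real^'p^'n) \<Rightarrow> real" where
  "selCDF \<Sigma> d \<tau> \<nu> m u a =
     (let g = (\<lambda>u'. scaled_chi_density (norm \<nu>) CARD('p) u' * seq_prob d \<tau> m (recon \<Sigma> \<nu> u' a))
      in set_lebesgue_integral lborel {0..u} g / set_lebesgue_integral lborel {0..} g)"

definition sel_pvalue :: "real^'p^'p \<Rightarrow> ('n set set \<Rightarrow> real^'p^'n \<Rightarrow> real) \<Rightarrow> real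
     \<Rightarrow> 'n set \<Rightarrow> 'n set \<Rightarrow> 'n set set list \<Rightarrow> real^'p^'n \<Rightarrow> real" where
  "sel_pvalue \<Sigma> d \<tau> C1 C2 m x =
     1 - selCDF \<Sigma> d \<tau> (contrast C1 C2) m (statU \<Sigma> (contrast C1 C2) x) (ancillary \<Sigma> (contrast C1 C2) x)"

end

theory Submission
  imports Defs
begin

text \<open>Let \<nu> be the contrast of the last merge, and write x = \<pi> + \<nu> w with w a row vector and \<pi> orthogonal
  to \<nu>. Under the null hypothesis \<nu> is also orthogonal to \<mu>, so the matrix normal density factors as a
  function of \<pi> times exp (-U^2 / (2 |\<nu>|^2)), where U is homogeneous of degree one in w. On the ray
  s \<mapsto> \<pi> + \<nu> (s w) the ancillary statistic is constant and, by the factor s^(p-1) of polar coordinates,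
  the law of U weighted by the selection probability has exactly the density whose distribution
  function is the selective CDF. The probability integral transform on each ray
  then gives the ratio \<alpha>, and integrating over all rays gives the claim. The normalising constant of the
  matrix normal density is never needed: it cancels in the conditional probability.\<close>

text \<open>Each value of the ancillary statistic has probability zero, and no conditional law given
  it is ever formed. Since \<open>cond_prob\<close> is a quotient, the claim says that the density
  times the selection probability has, over the event p-value \<le> \<alpha>, exactly \<alpha> times
  its total integral. Such an identity may be checked ray by ray, without any statement of
  independence between U, the direction and the residual. The price is two decompositions of
  Lebesgue measure, over fibres and over rays. Both arise by inserting a factor 1, exchanging
  nonnegative integrals and moving the variable. Orthogonality of \<nu> to \<mu> is the null
  hypothesis itself: the \<nu>-weighted sum of the rows of \<mu> is the difference of the two
  cluster means. Equality, rather than a mere bound by \<alpha>, is due to the selection probability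
  being positive everywhere, which makes the selective CDF strictly increasing along each
  ray.\<close>

subsection \<open>Square roots of positive definite matrices\<close>

lemma inner_matrix_mult_sym:
  assumes "sym_mat A" shows "u \<bullet> (A *v v) = (A *v u) \<bullet> v"
  using assms by (metis dot_lmul_matrix transpose_matrix_vector sym_mat_def)

lemma pos_def_invertible:
  fixes S :: "real^'p^'p"
  assumes "pos_def S" shows "invertible S"
proof -
  have "S *v x \<noteq> 0" if "x \<noteq> 0" for x
    using assms that by (auto simp: pos_def_def)
  hence "inj ((*v) S)"
    by (intro injI) (metis eq_iff_diff_eq_0 matrix_vector_mult_diff_distrib)
  thus ?thesis using invertible_left_inverse matrix_left_invertible_injective by blast
qed

text \<open>With D = R - S one has R D = - D S, so the traces of the positive semidefinite
  matrices D R D and D S D add up to zero.\<close>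
lemma pos_def_square_inject:
  fixes R S :: "real^'p^'p"
  assumes R: "pos_def R" and S: "pos_def S" and eq: "R ** R = S ** S"
  shows "R = S"
proof -
  define D where "D = R - S"
  have RD: "R = D + S" by (simp add: D_def)
  have symR: "sym_mat R" and symS: "sym_mat S" using R S by (auto simp: pos_def_def)
  have symD: "sym_mat D" using symR symS by (simp add: sym_mat_def D_def transpose_def vec_eq_iff)
  have nonneg: "v \<bullet> (A *v v) \<ge> 0" if "pos_def A" for A :: "real^'p^'p" and v
    using that by (cases "v = 0") (auto simp: pos_def_def less_imp_le)
  have q: "trace (D ** (A ** D)) = (\<Sum>i\<in>UNIV. (D *v axis i 1) \<bullet> (A *v (D *v axis i 1)))" for A
  proof -
    have "(D ** (A ** D)) $ i $ i = (D *v axis i 1) \<bullet> (A *v (D *v axis i 1))" for i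
    proof -
      have "(D ** (A ** D)) $ i $ i = axis i 1 \<bullet> ((D ** (A ** D)) *v axis i 1)"
        by (simp add: matrix_vector_mult_basis inner_axis' column_def)
      also have "\<dots> = axis i 1 \<bullet> (D *v (A *v (D *v axis i 1)))"
        by (simp add: matrix_vector_mul_assoc)
      also have "\<dots> = (D *v axis i 1) \<bullet> (A *v (D *v axis i 1))"
        by (rule inner_matrix_mult_sym[OF symD])
      finally show ?thesis .
    qed
    thus ?thesis by (simp add: trace_def)
  qed
  have "R ** R = R ** D + R ** S" by (simp add: D_def flip: matrix_add_ldistrib)
  moreover have "R ** S = D ** S + S ** S" 
    by (simp add: D_def matrix_matrix_mult_def vec_eq_iff left_diff_distrib sum_subtractf)
  ultimately have zero: "R ** D + D ** S = 0" using eq by simp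
  have "trace (D ** (R ** D)) + trace (D ** (S ** D)) = trace (D ** (R ** D)) + trace (D ** (D ** S))"
    by (metis matrix_mul_assoc trace_mul_sym)
  also have "\<dots> = trace (D ** (R ** D + D ** S))"
    by (simp add: trace_add matrix_add_ldistrib)
  also have "\<dots> = 0" by (simp add: zero trace_def)
  finally have "(\<Sum>i\<in>UNIV. (D *v axis i 1) \<bullet> (R *v (D *v axis i 1))) = 0"
    unfolding q using sum_nonneg[of UNIV "\<lambda>i. (D *v axis i 1) \<bullet> (R *v (D *v axis i 1))"]
      sum_nonneg[of UNIV "\<lambda>i. (D *v axis i 1) \<bullet> (S *v (D *v axis i 1))"] nonneg[OF R] nonneg[OF S]
    by (smt (verit))
  \<comment> \<open>Every summand is nonnegative, so each one vanishes, and definiteness of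
    \<open>R\<close> then kills each column of \<open>D\<close>.\<close>
  hence "(D *v axis i 1) \<bullet> (R *v (D *v axis i 1)) = 0" for i
    using nonneg[OF R] by (subst (asm) sum_nonneg_eq_0_iff) auto
  hence "D *v axis i 1 = 0" for i
    using R unfolding pos_def_def by (metis less_irrefl)
  hence "D = 0" by (simp add: matrix_vector_mult_basis column_def vec_eq_iff)
  thus ?thesis by (simp add: D_def)
qed

text \<open>For large c the matrix A = I - S/c is a strict contraction. Then Y \<mapsto> (A + Y^2)/2 is a contraction
  of a ball of self-adjoint operators, and its fixed point Y satisfies (I - Y)^2 = S/c.\<close>
lemma ex_pos_def_sqrt:
  fixes S :: "real^'p^'p"
  assumes S: "pos_def S"
  shows "\<exists>R. pos_def R \<and> R ** R = S"
proof -
  have symS: "sym_mat S" using S by (simp add: pos_def_def)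
  define K where "K = onorm ((*v) S)"
  have K: "norm (S *v v) \<le> K * norm v" for v
    unfolding K_def by (rule onorm) simp
  obtain \<delta> where \<delta>: "\<delta> > 0" "\<And>v. \<delta> * (norm v)\<^sup>2 \<le> v \<bullet> (S *v v)"
  proof -
    have "compact (sphere 0 1 :: (real^'p) set)" "sphere 0 1 \<noteq> ({} :: (real^'p) set)"
      by simp_all
    moreover have "continuous_on (sphere 0 1) (\<lambda>v. v \<bullet> (S *v v))"
      by (intro continuous_intros linear_continuous_on) (simp add: matrix_vector_mul_bounded_linear)
    ultimately obtain w where w: "w \<in> sphere 0 1" "\<And>v. v \<in> sphere 0 1 \<Longrightarrow> w \<bullet> (S *v w) \<le> v \<bullet> (S *v v)"
      using continuous_attains_inf[of "sphere 0 1" "\<lambda>v. v \<bullet> (S *v v)"] by blast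
    have "w \<bullet> (S *v w) > 0" using w(1) S unfolding pos_def_def by (metis mem_sphere_0 norm_zero zero_neq_one)
    moreover have "w \<bullet> (S *v w) * (norm v)\<^sup>2 \<le> v \<bullet> (S *v v)" for v
    proof (cases "v = 0")
      case False
      have "w \<bullet> (S *v w) \<le> (v /\<^sub>R norm v) \<bullet> (S *v (v /\<^sub>R norm v))"
        using False by (intro w(2)) simp
      also have "\<dots> = (v \<bullet> (S *v v)) / (norm v)\<^sup>2"
        by (simp add: matrix_vector_mult_scaleR power2_eq_square divide_inverse)
      finally show ?thesis using False by (simp add: field_simps)
    qed simp
    ultimately show ?thesis using that by blast
  qed
  have "K > 0"
  proof -
    have "norm (S *v axis undefined 1) > 0"
      using \<delta>(2)[of "axis undefined 1"] \<delta>(1) by (auto simp: norm_axis_1)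
    thus ?thesis using K[of "axis undefined 1"] unfolding norm_axis_1 by linarith
  qed
  have "\<delta> \<le> K"
  proof -
    have "\<delta> \<le> axis undefined 1 \<bullet> (S *v axis undefined 1)"
      using \<delta>(2)[of "axis undefined 1"] by (simp add: norm_axis_1)
    also have "\<dots> \<le> norm (axis undefined 1 :: real^'p) * norm (S *v axis undefined 1)"
      by (rule norm_cauchy_schwarz)
    finally show ?thesis using K[of "axis undefined 1"] by (simp add: norm_axis_1)
  qed
  \<comment> \<open>Expanding |v - S v / c|^2 gives at most (1 - 2 \<delta> / c + K^2 / c^2) |v|^2.
    This c minimises the factor and makes it 1 - \<delta>^2 / K^2, the square of \<rho>
    below.\<close>
  define c where "c = K\<^sup>2 / \<delta>"
  have "c > 0" using \<open>K > 0\<close> \<delta>(1) by (simp add: c_def)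
  define \<rho> where "\<rho> = sqrt (1 - \<delta>\<^sup>2 / K\<^sup>2)"
  have "\<delta>\<^sup>2 / K\<^sup>2 \<le> 1" "\<delta>\<^sup>2 / K\<^sup>2 > 0"
    using \<delta>(1) \<open>\<delta> \<le> K\<close> \<open>K > 0\<close> by (simp_all add: power_mono)
  hence \<rho>: "0 \<le> \<rho>" "\<rho> < 1" "\<rho>\<^sup>2 = 1 - \<delta>\<^sup>2 / K\<^sup>2"
    by (auto simp: \<rho>_def real_sqrt_less_iff[of _ 1, simplified])
  \<comment> \<open>Bounded linear operators form a complete space in the operator norm, the norm in
    which the contraction is estimated.\<close>
  define A where "A = id_blinfun - (1 / c) *\<^sub>R Blinfun ((*v) S)"
  have Sb: "blinfun_apply (Blinfun ((*v) S)) = (*v) S"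
    by (rule bounded_linear_Blinfun_apply) simp
  have A: "A v = v - (1 / c) *\<^sub>R (S *v v)" for v
    by (simp add: A_def blinfun.diff_left blinfun.scaleR_left Sb)
  have normA: "norm A \<le> \<rho>"
  proof (rule norm_blinfun_bound[OF \<rho>(1)])
    fix v
    have "(norm (A v))\<^sup>2 = (norm v)\<^sup>2 - 2 / c * (v \<bullet> (S *v v)) + (norm (S *v v))\<^sup>2 / c\<^sup>2"
      unfolding A power2_norm_eq_inner
      by (simp add: inner_diff_left inner_diff_right inner_commute[of "S *v v" v] power2_eq_square diff_divide_distrib)
    also have "\<dots> \<le> (norm v)\<^sup>2 - 2 / c * (\<delta> * (norm v)\<^sup>2) + (K * norm v)\<^sup>2 / c\<^sup>2"
      using \<open>c > 0\<close> by (intro add_mono diff_mono mult_left_mono divide_right_mono power_mono \<delta> K) auto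
    also have "\<dots> = (\<rho> * norm v)\<^sup>2"
      using \<delta>(1) \<open>K > 0\<close> unfolding power_mult_distrib \<rho>(3) c_def
      by (simp add: field_simps power2_eq_square)
    finally show "norm (A v) \<le> \<rho> * norm v"
      by (rule power2_le_imp_le) (use \<rho> in auto)
  qed
  \<comment> \<open>\<rho> is both radius and contraction factor: |\<Phi> Y| \<le> (\<rho> +
    \<rho>^2) / 2 \<le> \<rho>, and the Lipschitz constant is at most (\<rho> + \<rho>) / 2.
    Self-adjointness is a closed condition, so the fixed point inherits it.\<close>
  define X where "X = cball 0 \<rho> \<inter> {Y :: (real^'p) \<Rightarrow>\<^sub>L (real^'p). \<forall>u v. u \<bullet> Y v = Y u \<bullet> v}"
  define \<Phi> where "\<Phi> = (\<lambda>Y :: (real^'p) \<Rightarrow>\<^sub>L (real^'p). (1/2) *\<^sub>R (A + (Y o\<^sub>L Y)))"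
  have "closed {Y :: (real^'p) \<Rightarrow>\<^sub>L (real^'p). \<forall>u v. u \<bullet> Y v = Y u \<bullet> v}"
    by (intro closed_Collect_all closed_Collect_eq continuous_intros)
  hence "closed X" unfolding X_def by (intro closed_Int closed_cball)
  have "0 \<in> X" using \<rho> by (simp add: X_def)
  hence "X \<noteq> {}" by blast
  moreover have "\<Phi> ` X \<subseteq> X"
  proof (intro image_subsetI)
    fix Y assume Y: "Y \<in> X"
    have "norm (A + (Y o\<^sub>L Y)) \<le> norm A + norm Y * norm Y"
      using norm_triangle_ineq[of A "Y o\<^sub>L Y"] norm_blinfun_compose[of Y Y] by linarith
    also have "\<dots> \<le> \<rho> + \<rho> * 1"
      using Y \<rho> normA by (intro add_mono mult_mono) (auto simp: X_def)
    finally have "norm (\<Phi> Y) \<le> \<rho>" by (simp add: \<Phi>_def)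
    moreover have "u \<bullet> \<Phi> Y v = \<Phi> Y u \<bullet> v" for u v
    proof -
      have "\<And>u v. u \<bullet> Y v = Y u \<bullet> v" using Y by (simp add: X_def)
      thus ?thesis
        by (simp add: \<Phi>_def blinfun.scaleR_left blinfun.add_left A inner_simps inner_matrix_mult_sym[OF symS])
    qed
    ultimately show "\<Phi> Y \<in> X" by (simp add: X_def)
  qed
  moreover have "\<forall>Y\<in>X. \<forall>Z\<in>X. dist (\<Phi> Y) (\<Phi> Z) \<le> \<rho> * dist Y Z"
  proof (intro ballI)
    fix Y Z assume "Y \<in> X" "Z \<in> X"
    hence n: "norm Y \<le> \<rho>" "norm Z \<le> \<rho>" by (auto simp: X_def)
    \<comment> \<open>\<open>Y\<close> and \<open>Z\<close> need not commute, so Y^2 - Z^2 is split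
      as Y (Y - Z) + (Y - Z) Z.\<close>
    have "\<Phi> Y - \<Phi> Z = (1/2) *\<^sub>R ((Y o\<^sub>L (Y - Z)) + ((Y - Z) o\<^sub>L Z))"
      by (rule blinfun_eqI) (simp add: \<Phi>_def blinfun.bilinear_simps scaleR_add_right scaleR_diff_right)
    hence "2 * norm (\<Phi> Y - \<Phi> Z) = norm ((Y o\<^sub>L (Y - Z)) + ((Y - Z) o\<^sub>L Z))" by simp
    also have "\<dots> \<le> norm (Y o\<^sub>L (Y - Z)) + norm ((Y - Z) o\<^sub>L Z)" by (rule norm_triangle_ineq)
    also have "\<dots> \<le> norm Y * norm (Y - Z) + norm (Y - Z) * norm Z"
      by (intro add_mono norm_blinfun_compose)
    also have "\<dots> \<le> \<rho> * norm (Y - Z) + norm (Y - Z) * \<rho>"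
      using n by (intro add_mono mult_left_mono mult_right_mono) auto
    finally show "dist (\<Phi> Y) (\<Phi> Z) \<le> \<rho> * dist Y Z" by (simp add: dist_norm)
  qed
  ultimately obtain Y where Y: "Y \<in> X" "\<Phi> Y = Y"
    using Banach_fix[OF complete_eq_closed[THEN iffD2, OF \<open>closed X\<close>], of \<rho> \<Phi>] \<rho> by blast
  have symY: "u \<bullet> Y v = Y u \<bullet> v" for u v using Y(1) by (simp add: X_def)
  define R where "R = matrix (\<lambda>v. sqrt c *\<^sub>R (v - Y v))"
  have R: "R *v v = sqrt c *\<^sub>R (v - Y v)" for v
    unfolding R_def 
    by (rule matrix_works, unfold linear_matrix_vector_mul_eq) (auto intro!: linearI simp: blinfun.bilinear_simps algebra_simps)
  have fix_eq: "2 *\<^sub>R Y v = A v + Y (Y v)" for v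
    using arg_cong[OF Y(2), of "\<lambda>Z. 2 *\<^sub>R blinfun_apply Z v"] by (simp add: \<Phi>_def blinfun.bilinear_simps)
  have "(R ** R) *v v = S *v v" for v
  proof -
    have "(R ** R) *v v = c *\<^sub>R (v - 2 *\<^sub>R Y v + Y (Y v))"
      using \<open>c > 0\<close> by (simp add: R blinfun.bilinear_simps scaleR_2 algebra_simps flip: matrix_vector_mul_assoc)
    also have "v - 2 *\<^sub>R Y v + Y (Y v) = (1 / c) *\<^sub>R (S *v v)"
      unfolding fix_eq by (simp add: A)
    finally show ?thesis using \<open>c > 0\<close> by simp
  qed
  hence "R ** R = S" by (simp add: matrix_eq)
  moreover have "pos_def R"
  proof -
    have "u \<bullet> (R *v v) = (R *v u) \<bullet> v" for u v by (simp add: R inner_simps symY)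
    hence "axis j 1 \<bullet> (R *v axis i 1) = (R *v axis j 1) \<bullet> axis i 1" for i j .
    hence "R $ j $ i = R $ i $ j" for i j
      by (simp add: matrix_vector_mult_basis inner_axis inner_axis' column_def)
    hence "sym_mat R" by (simp add: sym_mat_def transpose_def vec_eq_iff)
    moreover have "v \<bullet> (R *v v) > 0" if "v \<noteq> 0" for v
    proof -
      have "v \<bullet> Y v \<le> norm v * (norm Y * norm v)"
        by (intro order.trans[OF norm_cauchy_schwarz] mult_left_mono norm_blinfun) auto
      also have "\<dots> \<le> norm v * (\<rho> * norm v)"
        using Y(1) by (intro mult_left_mono mult_right_mono) (auto simp: X_def)
      also have "\<dots> < norm v * (1 * norm v)"
        using \<rho> that by (intro mult_strict_left_mono mult_strict_right_mono) auto
      finally have "v \<bullet> (v - Y v) > 0" 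
        by (simp add: inner_diff_right dot_square_norm power2_eq_square)
      thus ?thesis using \<open>c > 0\<close> by (simp add: R)
    qed
    ultimately show ?thesis by (simp add: pos_def_def)
  qed
  ultimately show ?thesis by blast
qed

text \<open>\<open>mat_sqrt\<close> is a definite description, so it has its defining properties
  only once existence and uniqueness are both known.\<close>

lemma
  assumes "pos_def S"
  shows pos_def_mat_sqrt: "pos_def (mat_sqrt S)" and mat_sqrt_square: "mat_sqrt S ** mat_sqrt S = S"
proof -
  have "\<exists>!R. pos_def R \<and> R ** R = S"
    using ex_pos_def_sqrt[OF assms] pos_def_square_inject by blast
  from theI'[OF this] show "pos_def (mat_sqrt S)" "mat_sqrt S ** mat_sqrt S = S"
    by (auto simp: mat_sqrt_def)
qed

lemma
  fixes A :: "'a::semiring_1^'n^'m"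
  assumes "invertible A"
  shows matrix_inv_right: "A ** matrix_inv A = mat 1" and matrix_inv_left: "matrix_inv A ** A = mat 1"
  using someI_ex[OF assms[unfolded invertible_def]] by (auto simp: matrix_inv_def)

lemma mat_sqrt_mult_isqrt:
  assumes "pos_def S"
  shows "mat_sqrt S *v (mat_isqrt S *v v) = v" and "mat_isqrt S *v (mat_sqrt S *v v) = v"
proof -
  have "invertible (mat_sqrt S)" using assms by (intro pos_def_invertible pos_def_mat_sqrt)
  hence "mat_sqrt S ** mat_isqrt S = mat 1" "mat_isqrt S ** mat_sqrt S = mat 1"
    unfolding mat_isqrt_def by (auto simp: matrix_inv_right matrix_inv_left)
  thus "mat_sqrt S *v (mat_isqrt S *v v) = v" "mat_isqrt S *v (mat_sqrt S *v v) = v"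
    by (simp_all add: matrix_vector_mul_assoc)
qed

text \<open>Links the quadratic form in the normal density, written with \<open>matrix_inv\<close>,
  to the statistic, written with \<open>mat_isqrt\<close>.\<close>

lemma inner_matrix_inv_isqrt:
  assumes S: "pos_def S"
  shows "v \<bullet> (matrix_inv S *v v) = (norm (mat_isqrt S *v v))\<^sup>2"
proof -
  let ?R = "mat_sqrt S" and ?T = "mat_isqrt S"
  have "S ** matrix_inv S = mat 1" using S by (simp add: matrix_inv_right pos_def_invertible)
  hence "?R *v (?R *v (matrix_inv S *v v)) = v"
    by (simp add: matrix_vector_mul_assoc matrix_mul_assoc mat_sqrt_square[OF S])
  hence "matrix_inv S *v v = ?T *v (?T *v v)"
    by (metis mat_sqrt_mult_isqrt(2)[OF S])
  moreover have "sym_mat ?R" using pos_def_mat_sqrt[OF S] by (simp add: pos_def_def)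
  hence "(?R *v (?T *v v)) \<bullet> (?T *v (?T *v v)) = (?T *v v) \<bullet> (?R *v (?T *v (?T *v v)))"
    by (simp add: inner_matrix_mult_sym)
  ultimately show ?thesis by (simp add: mat_sqrt_mult_isqrt[OF S] power2_norm_eq_inner)
qed

subsection \<open>Integration along fibres and rays\<close>

lemma nn_integral_lborel_translate:
  fixes f :: "'a::euclidean_space \<Rightarrow> ennreal"
  assumes [measurable]: "f \<in> borel_measurable borel"
  shows "(\<integral>\<^sup>+x. f (x + a) \<partial>lborel) = (\<integral>\<^sup>+x. f x \<partial>lborel)"
proof -
  have "(\<integral>\<^sup>+x. f x \<partial>lborel) = (\<integral>\<^sup>+x. f x \<partial>distr lborel borel ((+) a))"
    by (simp add: lborel_distr_plus)
  also have "\<dots> = (\<integral>\<^sup>+x. f (a + x) \<partial>lborel)"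
    by (rule nn_integral_distr) auto
  finally show ?thesis by (simp add: add.commute)
qed

lemma nn_integral_lborel_scale:
  fixes f :: "'a::euclidean_space \<Rightarrow> ennreal"
  assumes [measurable]: "f \<in> borel_measurable borel" and "s > 0"
  shows "(\<integral>\<^sup>+x. f x \<partial>lborel) = ennreal (s ^ DIM('a)) * (\<integral>\<^sup>+x. f (s *\<^sub>R x) \<partial>lborel)"
proof -
  have "(lborel :: 'a measure) = density (distr lborel borel (\<lambda>x. 0 + s *\<^sub>R x)) (\<lambda>_. ennreal (\<bar>s\<bar> ^ DIM('a)))"
    using assms(2) by (intro lborel_affine) simp
  hence "(\<integral>\<^sup>+x. f x \<partial>lborel) = (\<integral>\<^sup>+x. f x \<partial>density (distr lborel borel (\<lambda>x. 0 + s *\<^sub>R x)) (\<lambda>_. ennreal (\<bar>s\<bar> ^ DIM('a))))"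
    by simp
  also have "\<dots> = (\<integral>\<^sup>+x. ennreal (s ^ DIM('a)) * f (s *\<^sub>R x) \<partial>lborel)"
    using assms(2) by (subst nn_integral_density) (auto simp: nn_integral_distr)
  also have "\<dots> = ennreal (s ^ DIM('a)) * (\<integral>\<^sup>+x. f (s *\<^sub>R x) \<partial>lborel)"
    by (rule nn_integral_cmult) simp
  finally show ?thesis .
qed

text \<open>Averaging over the fibres of W avoids choosing a basis adapted to the range of L.\<close>
lemma nn_integral_lborel_fibre:
  fixes f :: "'a::euclidean_space \<Rightarrow> ennreal" and W :: "'a \<Rightarrow> 'b::euclidean_space"
  assumes [measurable]: "f \<in> borel_measurable borel" "W \<in> borel_measurable borel" "L \<in> borel_measurable borel"
    and W: "\<And>x w. W (x + L w) = W x + w" and L: "\<And>v w. L (v + w) = L v + L w"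
  shows "(\<integral>\<^sup>+x. f x \<partial>lborel) =
    (\<integral>\<^sup>+x. indicator (cbox 0 One) (W x) * (\<integral>\<^sup>+w. f (x - L (W x) + L w) \<partial>lborel) \<partial>lborel)"
proof -
  \<comment> \<open>The unit cube has volume one, so integrating \<open>?I (W x - w)\<close> over w
    inserts a factor 1. Translating x by \<open>L w\<close> turns the cutoff into
    \<open>?I (W x)\<close>, and w remains as the coordinate along the fibre.\<close>
  let ?I = "indicator (cbox 0 One) :: 'b \<Rightarrow> ennreal"
  have one: "(\<integral>\<^sup>+w. ?I (v - w) \<partial>lborel) = 1" for v
  proof -
    have "(\<integral>\<^sup>+w. ?I (v - w) \<partial>lborel) = (\<integral>\<^sup>+w. indicator (cbox (v - One) v) w \<partial>lborel)"
      by (intro nn_integral_cong) (auto simp: indicator_def mem_box algebra_simps)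
    also have "\<dots> = 1"
      by (simp add: emeasure_lborel_cbox_eq algebra_simps)
    finally show ?thesis .
  qed
  \<comment> \<open>The integral over a fibre does not depend on the base point, which may be moved
    to the point of the fibre where \<open>W\<close> vanishes.\<close>
  have inner: "(\<integral>\<^sup>+w. f (x + L w) \<partial>lborel) = (\<integral>\<^sup>+w. f (x - L (W x) + L w) \<partial>lborel)" for x
  proof -
    have "(\<integral>\<^sup>+w. f (x - L (W x) + L w) \<partial>lborel) = (\<integral>\<^sup>+w. f (x - L (W x) + L (w + W x)) \<partial>lborel)"
      by (rule nn_integral_lborel_translate[symmetric]) simp
    thus ?thesis by (simp add: L algebra_simps)
  qed
  have "(\<integral>\<^sup>+x. f x \<partial>lborel) = (\<integral>\<^sup>+x. (\<integral>\<^sup>+w. f x * ?I (W x - w) \<partial>lborel) \<partial>lborel)"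
    by (simp add: nn_integral_cmult one)
  also have "\<dots> = (\<integral>\<^sup>+w. (\<integral>\<^sup>+x. f x * ?I (W x - w) \<partial>lborel) \<partial>lborel)"
    by (rule lborel_pair.Fubini') measurable
  also have "\<dots> = (\<integral>\<^sup>+w. (\<integral>\<^sup>+x. f (x + L w) * ?I (W x) \<partial>lborel) \<partial>lborel)"
  proof (rule nn_integral_cong)
    fix w
    have "(\<integral>\<^sup>+x. f x * ?I (W x - w) \<partial>lborel) = (\<integral>\<^sup>+x. f (x + L w) * ?I (W (x + L w) - w) \<partial>lborel)"
      by (rule nn_integral_lborel_translate[symmetric]) measurable
    thus "(\<integral>\<^sup>+x. f x * ?I (W x - w) \<partial>lborel) = (\<integral>\<^sup>+x. f (x + L w) * ?I (W x) \<partial>lborel)"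
      by (simp add: W)
  qed
  also have "\<dots> = (\<integral>\<^sup>+x. (\<integral>\<^sup>+w. ?I (W x) * f (x + L w) \<partial>lborel) \<partial>lborel)"
    by (subst lborel_pair.Fubini') (measurable, simp add: mult.commute)
  also have "\<dots> = (\<integral>\<^sup>+x. ?I (W x) * (\<integral>\<^sup>+w. f (x - L (W x) + L w) \<partial>lborel) \<partial>lborel)"
    by (simp add: nn_integral_cmult flip: inner)
  finally show ?thesis .
qed

text \<open>Polar coordinates without a surface measure: the sphere is replaced by a shell.\<close>
lemma nn_integral_lborel_rays:
  fixes f :: "'a::euclidean_space \<Rightarrow> ennreal"
  assumes [measurable]: "f \<in> borel_measurable borel"
  shows "(\<integral>\<^sup>+x. f x \<partial>lborel) =
    (\<integral>\<^sup>+x. ennreal (indicator {1/2..<1} (norm x) / norm x) *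
       (\<integral>\<^sup>+s. ennreal (s ^ (DIM('a) - 1)) * f (s *\<^sub>R x) * indicator {0<..} s \<partial>lborel) \<partial>lborel)"
proof -
  \<comment> \<open>For nonzero x this is a probability density in s, on an interval of length |x|.
    Substituting s x for x turns its support into 1/2 \<le> |x| < 1 and its height into 1 / (s |x|),
    which takes one power of s off the Jacobian.\<close>
  let ?k = "\<lambda>(x::'a) s. ennreal (if norm x < s \<and> s \<le> 2 * norm x then 1 / norm x else 0)"
  have one: "(\<integral>\<^sup>+s. ?k x s \<partial>lborel) = 1" if "x \<noteq> 0" for x :: 'a
  proof -
    have "(\<integral>\<^sup>+s. ?k x s \<partial>lborel) = (\<integral>\<^sup>+s. ennreal (1 / norm x) * indicator {norm x<..2 * norm x} s \<partial>lborel)"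
      by (intro nn_integral_cong) (auto simp: indicator_def)
    also have "\<dots> = ennreal (1 / norm x) * ennreal (norm x)"
      by (simp add: nn_integral_cmult)
    also have "\<dots> = 1" using that by (simp flip: ennreal_mult add: ennreal_1)
    finally show ?thesis .
  qed
  have kp: "?k x s = ?k x s * indicator {0<..} s" for x :: 'a and s
    by (auto simp: indicator_def)
  have "(\<integral>\<^sup>+x. f x \<partial>lborel) = (\<integral>\<^sup>+x. (\<integral>\<^sup>+s. f x * ?k x s \<partial>lborel) \<partial>lborel)"
    using AE_lborel_singleton[of "0::'a"]
    by (intro nn_integral_cong_AE) (auto simp: nn_integral_cmult one elim!: eventually_mono)
  also have "\<dots> = (\<integral>\<^sup>+s. (\<integral>\<^sup>+x. f x * ?k x s \<partial>lborel) \<partial>lborel)"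
    by (rule lborel_pair.Fubini') measurable
  also have "\<dots> = (\<integral>\<^sup>+s. (\<integral>\<^sup>+x. ennreal (indicator {1/2..<1} (norm x) / norm x) *
      (ennreal (s ^ (DIM('a) - 1)) * f (s *\<^sub>R x) * indicator {0<..} s) \<partial>lborel) \<partial>lborel)"
  proof (rule nn_integral_cong)
    fix s :: real
    show "(\<integral>\<^sup>+x. f x * ?k x s \<partial>lborel) = (\<integral>\<^sup>+x. ennreal (indicator {1/2..<1} (norm x) / norm x) *
      (ennreal (s ^ (DIM('a) - 1)) * f (s *\<^sub>R x) * indicator {0<..} s) \<partial>lborel)"
    proof (cases "s > 0")
      case False
      thus ?thesis by (subst kp) simp
    next
      case True
      have k: "ennreal (s ^ DIM('a)) * ?k (s *\<^sub>R x) s =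
          ennreal (indicator {1/2..<1} (norm x) / norm x) * ennreal (s ^ (DIM('a) - 1))" for x :: 'a
      proof -
        have i: "(if norm (s *\<^sub>R x) < s \<and> s \<le> 2 * norm (s *\<^sub>R x) then 1 / norm (s *\<^sub>R x) else 0)
            = indicator {1/2..<1} (norm x) / (s * norm x)"
          using True by (auto simp: indicator_def)
        have "s ^ DIM('a) = s * s ^ (DIM('a) - 1)"
          using power_eq_if[of s "DIM('a)"] by simp
        thus ?thesis using True unfolding i
          by (subst (1 2) ennreal_mult[symmetric]) (auto simp: field_simps)
      qed
      have "(\<integral>\<^sup>+x. f x * ?k x s \<partial>lborel) =
          ennreal (s ^ DIM('a)) * (\<integral>\<^sup>+x. f (s *\<^sub>R x) * ?k (s *\<^sub>R x) s \<partial>lborel)"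
        by (rule nn_integral_lborel_scale[OF _ True]) measurable
      also have "\<dots> = (\<integral>\<^sup>+x. (ennreal (s ^ DIM('a)) * ?k (s *\<^sub>R x) s) * f (s *\<^sub>R x) \<partial>lborel)"
        by (subst nn_integral_cmult[symmetric]) (measurable, simp add: mult_ac)
      finally show ?thesis using True unfolding k by (simp add: mult_ac)
    qed
  qed
  also have "\<dots> = (\<integral>\<^sup>+x. (\<integral>\<^sup>+s. ennreal (indicator {1/2..<1} (norm x) / norm x) *
      (ennreal (s ^ (DIM('a) - 1)) * f (s *\<^sub>R x) * indicator {0<..} s) \<partial>lborel) \<partial>lborel)"
    by (rule lborel_pair.Fubini') measurable
  finally show ?thesis by (simp add: nn_integral_cmult)
qed

text \<open>The probability integral transform for an unnormalised density. The partial integral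
  \<open>G\<close> is continuous and strictly increasing with limit \<open>D\<close>, so for
  \<alpha> > 0 the level (1 - \<alpha>) D is reached at one point u0, and the event is, up to a null
  set, the tail beyond u0, of mass \<alpha> D.\<close>

lemma nn_integral_upper_tail:
  fixes g :: "real \<Rightarrow> real"
  assumes g: "set_integrable lborel {0..} g" and pos: "\<And>u. u > 0 \<Longrightarrow> g u > 0"
    and \<alpha>: "0 \<le> \<alpha>" "\<alpha> \<le> 1"
  defines "F \<equiv> \<lambda>u. set_lebesgue_integral lborel {0..u} g / set_lebesgue_integral lborel {0..} g"
  shows "(\<integral>\<^sup>+u. ennreal (g u) * indicator {u. 1 - F u \<le> \<alpha>} u * indicator {0<..} u \<partial>lborel) =
    ennreal \<alpha> * (\<integral>\<^sup>+u. ennreal (g u) * indicator {0<..} u \<partial>lborel)"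
proof -
  define I where "I = (\<lambda>A. set_lebesgue_integral lborel A g)"
  define D where "D = I {0..}"
  define G where "G = (\<lambda>u. I {0..u})"
  have F: "F u = G u / D" for u by (simp add: F_def G_def I_def D_def)
  have gi: "set_integrable lborel A g" if "A \<subseteq> {0..}" "A \<in> sets borel" for A
    using set_integrable_subset[OF g] that by simp
  have split: "I (A \<union> B) = I A + I B"
    if "A \<subseteq> {0..}" "A \<in> sets borel" "B \<subseteq> {0..}" "B \<in> sets borel" "A \<inter> B = {}" for A B
    unfolding I_def using that by (intro set_integral_Un gi) auto
  have nn: "(\<integral>\<^sup>+u. ennreal (g u) * indicator A u \<partial>lborel) = ennreal (I A)"
    if "A \<subseteq> {0<..}" "A \<in> sets borel" for A
  proof -
    have A: "A \<subseteq> {0..}" using that by auto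
    have "(\<integral>\<^sup>+u. ennreal (g u) * indicator A u \<partial>lborel) = (\<integral>\<^sup>+u. ennreal (indicator A u *\<^sub>R g u) \<partial>lborel)"
      by (intro nn_integral_cong) (auto simp: indicator_def)
    also have "\<dots> = ennreal (I A)"
      unfolding set_lebesgue_integral_def I_def using gi[OF A that(2)] that pos
      by (intro nn_integral_eq_integral AE_I2) (auto simp: set_integrable_def indicator_def less_imp_le subset_eq)
    finally show ?thesis .
  qed
  have I_nonneg: "I A \<ge> 0" if "A \<subseteq> {0<..}" for A
    unfolding I_def set_lebesgue_integral_def using that pos
    by (intro integral_nonneg_AE AE_I2) (auto simp: indicator_def less_imp_le subset_eq)
  \<comment> \<open>Strict growth of \<open>G\<close> is what makes the event exactly a half line. A
    zero integral of a positive function would make the interval a null set.\<close>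
  have I_pos: "I {u<..v} > 0" if "0 \<le> u" "u < v" for u v
  proof -
    have "set_integrable lborel {u<..v} g" using that by (intro gi) auto
    have "I {u<..v} \<noteq> 0"
    proof
      assume "I {u<..v} = 0"
      hence "AE x in lborel. indicator {u<..v} x *\<^sub>R g x = 0"
        unfolding I_def set_lebesgue_integral_def using \<open>set_integrable lborel {u<..v} g\<close> that pos
        by (subst (asm) integral_nonneg_eq_0_iff_AE) (auto simp: set_integrable_def indicator_def less_imp_le intro!: AE_I2)
      hence "AE x in lborel. x \<notin> {u<..v}"
        using pos that by (auto elim!: eventually_mono simp: indicator_def split: if_splits) (smt (verit))
      hence "emeasure lborel {u<..v} = 0"
        by (subst (asm) AE_iff_measurable[of "{u<..v}"]) auto
      thus False using that by simp
    qed
    moreover have "I {u<..v} \<ge> 0" using that by (intro I_nonneg) auto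
    ultimately show ?thesis by linarith
  qed
  have G_step: "G v = G u + I {u<..v}" if "0 \<le> u" "u \<le> v" for u v
  proof -
    have "{0..v} = {0..u} \<union> {u<..v}" using that by auto
    thus ?thesis unfolding G_def by (simp only:) (rule split, use that in auto)
  qed
  have D_step: "D = G u + I {u<..}" if "0 \<le> u" for u
  proof -
    have "{0..} = {0..u} \<union> {u<..}" using that by auto
    thus ?thesis unfolding D_def G_def by (simp only:) (rule split, use that in auto)
  qed
  have G_less: "G u < G v" if "0 \<le> u" "u < v" for u v
    using G_step[of u v] I_pos[of u v] that by simp
  have D_gt: "G u < D" if "0 \<le> u" for u
    using G_less[of u "u + 1"] D_step[of "u + 1"] I_nonneg[of "{u + 1<..}"] that by auto
  have G0: "G 0 = 0"
    unfolding G_def I_def set_lebesgue_integral_def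
    by (intro integral_eq_zero_AE, rule eventually_mono[OF AE_lborel_singleton[of 0]]) auto
  have "D > 0" using D_gt[of 0] G0 by simp
  have lhs: "(\<integral>\<^sup>+u. ennreal (g u) * indicator {u. 1 - F u \<le> \<alpha>} u * indicator {0<..} u \<partial>lborel) =
      (\<integral>\<^sup>+u. ennreal (g u) * indicator {u. 0 < u \<and> (1 - \<alpha>) * D \<le> G u} u \<partial>lborel)"
    using \<open>D > 0\<close> by (intro nn_integral_cong) (auto simp: indicator_def F field_simps)
  have rhs: "ennreal \<alpha> * (\<integral>\<^sup>+u. ennreal (g u) * indicator {0<..} u \<partial>lborel) = ennreal (\<alpha> * D)"
    using D_step[of 0] G0 \<alpha> I_nonneg[of "{0<..}"] by (simp add: nn ennreal_mult)
  have at_level: ?thesis if "0 \<le> u0" "G u0 = (1 - \<alpha>) * D" for u0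
  proof -
    have "(1 - \<alpha>) * D \<le> G u \<longleftrightarrow> u0 \<le> u" if "u > 0" for u
      using G_less[of u u0] G_less[of u0 u] that \<open>0 \<le> u0\<close> \<open>G u0 = _\<close> by (cases u u0 rule: linorder_cases) auto
    hence "(\<integral>\<^sup>+u. ennreal (g u) * indicator {u. 0 < u \<and> (1 - \<alpha>) * D \<le> G u} u \<partial>lborel) =
        (\<integral>\<^sup>+u. ennreal (g u) * indicator {u0<..} u \<partial>lborel)"
      using that(1) by (intro nn_integral_cong_AE eventually_mono[OF AE_lborel_singleton[of u0]])
        (auto simp: indicator_def)
    also have "\<dots> = ennreal (I {u0<..})" using that by (intro nn) auto
    also have "I {u0<..} = \<alpha> * D" using D_step[of u0] that by (simp add: algebra_simps)
    finally show ?thesis unfolding lhs rhs .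
  qed
  show ?thesis
  \<comment> \<open>For \<alpha> = 0 the level is \<open>D\<close> itself, which \<open>G\<close>
    never attains: the event is empty and the intermediate value theorem does not apply.\<close>
  proof (cases "\<alpha> = 0")
    case True
    have "(\<integral>\<^sup>+u. ennreal (g u) * indicator {u. 0 < u \<and> (1 - \<alpha>) * D \<le> G u} u \<partial>lborel) = (\<integral>\<^sup>+(u::real). 0 \<partial>lborel)"
      using True D_gt by (intro nn_integral_cong) (auto simp: indicator_def not_le less_imp_le)
    thus ?thesis unfolding lhs rhs using True by simp
  next
    case False
    have lim: "(G \<longlongrightarrow> D) at_top"
      unfolding G_def D_def I_def using gi by (intro tendsto_set_lebesgue_integral_at_top) auto
    have "(1 - \<alpha>) * D < D" using False \<alpha> \<open>D > 0\<close> by simp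
    from order_tendstoD(1)[OF lim this]
    obtain N where "\<And>u. u \<ge> N \<Longrightarrow> (1 - \<alpha>) * D < G u" by (auto simp: eventually_at_top_linorder)
    hence b: "(1 - \<alpha>) * D \<le> G (max 0 N)" by (simp add: less_imp_le)
    have cont: "continuous_on {0..max 0 N} G"
    proof -
      have "G u = integral {0..u} g" for u
        unfolding G_def I_def by (rule set_borel_integral_eq_integral) (rule gi, auto)
      moreover have "g integrable_on {0..max 0 N}"
        by (rule set_borel_integral_eq_integral) (rule gi, auto)
      ultimately show ?thesis by (simp add: indefinite_integral_continuous_1)
    qed
    have "G 0 \<le> (1 - \<alpha>) * D" using \<alpha> \<open>D > 0\<close> by (simp add: G0)
    from IVT'[OF this b _ cont] show ?thesis using at_level by auto
  qed
qed

subsection \<open>Gaussian and chi densities\<close>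

text \<open>Up to the factor sqrt (2 pi c^2) this is an absolute moment of the centred normal law
  with standard deviation c.\<close>

lemma integrable_gaussian_power:
  assumes "c > 0"
  shows "integrable lborel (\<lambda>u::real. \<bar>u\<bar> ^ k * exp (- (u / c)\<^sup>2 / 2))"
proof -
  have "integrable lborel (\<lambda>u. sqrt (2 * pi * c\<^sup>2) * (normal_density 0 c u * \<bar>u - 0\<bar> ^ k))"
    using assms by (intro integrable_mult_right integrable_normal_moment_abs)
  thus ?thesis
    by (rule back_subst[where P = "integrable lborel"])
      (use assms in \<open>auto simp: normal_density_def power_divide\<close>)
qed

text \<open>Only finiteness is at stake, so crude bounds suffice: over the shell of the ray
  decomposition the radial integral is at most \<open>B\<close>, and the shell lies in a ball of
  finite volume.\<close>

lemma nn_integral_gaussian_finite: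
  assumes "c > 0"
  shows "(\<integral>\<^sup>+x. ennreal (exp (- (norm (x - a :: 'a::euclidean_space) / c)\<^sup>2 / 2)) \<partial>lborel) < \<infinity>"
proof -
  define k where "k = DIM('a) - 1"
  \<comment> \<open>On the shell |x| \<ge> 1/2, hence |s x| / c \<ge> s / (2 c); this is the origin
    of 2 c. The factor 2 in front of \<open>B\<close> below comes from 1 / |x| \<le> 2.\<close>
  define B where "B = (\<integral>\<^sup>+s. ennreal (\<bar>s\<bar> ^ k * exp (- (s / (2 * c))\<^sup>2 / 2)) \<partial>lborel)"
  have "B < \<infinity>"
    using integrable_gaussian_power[of "2 * c" k] assms
    unfolding B_def integrable_iff_bounded by (simp add: abs_mult power_abs)
  have "(\<integral>\<^sup>+x. ennreal (exp (- (norm (x - a :: 'a) / c)\<^sup>2 / 2)) \<partial>lborel) =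
      (\<integral>\<^sup>+x. ennreal (exp (- (norm (x :: 'a) / c)\<^sup>2 / 2)) \<partial>lborel)"
    using nn_integral_lborel_translate[of "\<lambda>x::'a. ennreal (exp (- (norm x / c)\<^sup>2 / 2))" "- a"] by simp
  also have "\<dots> = (\<integral>\<^sup>+x. ennreal (indicator {1/2..<1} (norm (x::'a)) / norm x) *
       (\<integral>\<^sup>+s. ennreal (s ^ k) * ennreal (exp (- (norm (s *\<^sub>R x) / c)\<^sup>2 / 2)) * indicator {0<..} s \<partial>lborel) \<partial>lborel)"
    unfolding k_def by (rule nn_integral_lborel_rays) measurable
  also have "\<dots> \<le> (\<integral>\<^sup>+x. (2 * B) * indicator (ball (0::'a) 1) x \<partial>lborel)"
  proof (rule nn_integral_mono)
    fix x :: 'a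
    show "ennreal (indicator {1/2..<1} (norm x) / norm x) *
       (\<integral>\<^sup>+s. ennreal (s ^ k) * ennreal (exp (- (norm (s *\<^sub>R x) / c)\<^sup>2 / 2)) * indicator {0<..} s \<partial>lborel)
       \<le> (2 * B) * indicator (ball 0 1) x"
    proof (cases "norm x \<in> {1/2..<1}")
      case True
      have "(\<integral>\<^sup>+s. ennreal (s ^ k) * ennreal (exp (- (norm (s *\<^sub>R x) / c)\<^sup>2 / 2)) * indicator {0<..} s \<partial>lborel) \<le> B"
        unfolding B_def
      proof (rule nn_integral_mono)
        fix s :: real
        show "ennreal (s ^ k) * ennreal (exp (- (norm (s *\<^sub>R x) / c)\<^sup>2 / 2)) * indicator {0<..} s
          \<le> ennreal (\<bar>s\<bar> ^ k * exp (- (s / (2 * c))\<^sup>2 / 2))"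
        proof (cases "s > 0")
          case s: True
          have "s / (2 * c) \<le> norm (s *\<^sub>R x) / c"
            using True s assms by (simp add: field_simps)
          hence "(s / (2 * c))\<^sup>2 \<le> (norm (s *\<^sub>R x) / c)\<^sup>2"
            using s assms by (intro power_mono) auto
          thus ?thesis using s
            by (auto simp flip: ennreal_mult intro!: ennreal_leI mult_left_mono)
        qed simp
      qed
      moreover have "ennreal (indicator {1/2..<1} (norm x) / norm x) \<le> ennreal 2"
        using True frac_le[of 1 1 "1/2" "norm x"] by (intro ennreal_leI) auto
      ultimately show ?thesis using True by (auto simp: intro!: mult_mono)
    qed simp
  qed
  also have "\<dots> = 2 * B * emeasure lborel (ball (0::'a) 1)"
    by (simp add: nn_integral_cmult_indicator)
  also have "\<dots> < \<infinity>"
    using \<open>B < \<infinity>\<close> emeasure_bounded_finite[of "ball (0::'a) 1"] by (auto simp: ennreal_mult_less_top)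
  finally show ?thesis .
qed

text \<open>Gathers in Z every factor free of u. Only Z > 0 matters, because Z is absorbed in the
  constant that relates the density on a ray to the chi weight.\<close>

lemma scaled_chi_density_gaussian:
  assumes "c > 0" "k > 0"
  obtains Z where "Z > 0"
    "\<And>u. u > 0 \<Longrightarrow> scaled_chi_density c k u = Z * (u ^ (k - 1) * exp (- (u / c)\<^sup>2 / 2))"
proof
  define Z where "Z = 1 / (c ^ (k - 1) * c * (2 powr (real k / 2 - 1) * Gamma (real k / 2)))"
  show "Z > 0" using assms by (auto simp: Z_def intro!: mult_pos_pos Gamma_real_pos)
  show "scaled_chi_density c k u = Z * (u ^ (k - 1) * exp (- (u / c)\<^sup>2 / 2))" if "u > 0" for u
    using that assms by (simp add: scaled_chi_density_def chi_density_def Z_def power_divide)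
qed

lemma measurable_scaled_chi_density[measurable]: "scaled_chi_density c k \<in> borel_measurable borel"
  unfolding scaled_chi_density_def chi_density_def by measurable

lemma integrable_scaled_chi_density:
  assumes "c > 0" "k > 0"
  shows "integrable lborel (scaled_chi_density c k)"
proof -
  obtain Z where Z: "Z > 0" "\<And>u. u > 0 \<Longrightarrow> scaled_chi_density c k u = Z * (u ^ (k - 1) * exp (- (u / c)\<^sup>2 / 2))"
    using scaled_chi_density_gaussian[OF assms] by blast
  have "integrable lborel (\<lambda>u. Z * (\<bar>u\<bar> ^ (k - 1) * exp (- (u / c)\<^sup>2 / 2)))"
    using integrable_gaussian_power[OF assms(1)] by (rule integrable_mult_right)
  thus ?thesis
  proof (rule Bochner_Integration.integrable_bound)
    have "norm (scaled_chi_density c k u) \<le> norm (Z * (\<bar>u\<bar> ^ (k - 1) * exp (- (u / c)\<^sup>2 / 2)))" for u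
      using Z assms by (cases "u > 0") (auto simp: scaled_chi_density_def chi_density_def zero_less_divide_iff)
    thus "AE u in lborel. norm (scaled_chi_density c k u) \<le> norm (Z * (\<bar>u\<bar> ^ (k - 1) * exp (- (u / c)\<^sup>2 / 2)))"
      by simp
  qed measurable
qed

lemma power2_norm_vec: "(norm x)\<^sup>2 = (\<Sum>i\<in>UNIV. (norm (x $ i))\<^sup>2)"
  for x :: "'a::real_inner ^ 'n"
  by (simp add: power2_norm_eq_inner inner_vec_def)

lemma mn_density_exp:
  fixes \<mu> x :: "real^'p^'n"
  assumes "pos_def \<Sigma>"
  shows "mn_density \<mu> \<Sigma> x =
    exp (- (\<Sum>i\<in>UNIV. (norm (mat_isqrt \<Sigma> *v (x $ i - \<mu> $ i)))\<^sup>2) / 2) /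
      sqrt ((2 * pi) ^ CARD('p) * det \<Sigma>) ^ CARD('n)"
  unfolding mn_density_def inner_matrix_inv_isqrt[OF assms]
  by (simp add: prod_dividef flip: exp_sum) (simp add: sum_negf sum_divide_distrib)

text \<open>The normaliser contains the square root of \<open>det \<Sigma>\<close>, which is
  positive as the square of the nonzero determinant of \<open>mat_sqrt \<Sigma>\<close>.\<close>

lemma mn_density_pos:
  fixes \<mu> x :: "real^'p^'n"
  assumes "pos_def \<Sigma>" shows "mn_density \<mu> \<Sigma> x > 0"
proof -
  let ?R = "mat_sqrt \<Sigma>"
  have "det ?R \<noteq> 0"
    using pos_def_invertible[OF pos_def_mat_sqrt[OF assms]] by (simp add: invertible_det_nz)
  moreover have "det \<Sigma> = det ?R * det ?R"
    by (simp add: mat_sqrt_square[OF assms] flip: det_mul)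
  ultimately have "det \<Sigma> > 0" by (simp add: zero_less_mult_iff) (metis linorder_neqE_linordered_idom)
  thus ?thesis by (simp add: mn_density_exp[OF assms])
qed

lemma measurable_mn_density[measurable]: "mn_density \<mu> \<Sigma> \<in> borel_measurable borel"
proof -
  have "continuous_on UNIV (\<lambda>x. (x $ i - \<mu> $ i) \<bullet> (matrix_inv \<Sigma> *v (x $ i - \<mu> $ i)))" for i
    by (intro continuous_on_inner continuous_on_diff continuous_on_component continuous_on_id continuous_on_const
        bounded_linear.continuous_on[OF matrix_vector_mul_bounded_linear])
  hence [measurable]: "(\<lambda>x. (x $ i - \<mu> $ i) \<bullet> (matrix_inv \<Sigma> *v (x $ i - \<mu> $ i))) \<in> borel_measurable borel" for i
    by (rule borel_measurable_continuous_onI)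
  show ?thesis unfolding mn_density_def by measurable
qed

text \<open>An operator bound c for the square root of \<Sigma> gives |v| / c as a lower bound for
  the norm of \<open>mat_isqrt \<Sigma> *v v\<close>, so a spherical Gaussian dominates the
  density.\<close>

lemma nn_integral_mn_density_finite:
  fixes \<mu> :: "real^'p^'n"
  assumes S: "pos_def \<Sigma>"
  shows "(\<integral>\<^sup>+x. ennreal (mn_density \<mu> \<Sigma> x) \<partial>lborel) < \<infinity>"
proof -
  obtain c where c: "c > 0" "\<And>v. norm (mat_sqrt \<Sigma> *v v) \<le> norm v * c"
    using bounded_linear.pos_bounded[OF matrix_vector_mul_bounded_linear] by blast
  define Z where "Z = sqrt ((2 * pi) ^ CARD('p) * det \<Sigma>) ^ CARD('n)"
  have "Z > 0" using mn_density_pos[OF S, of \<mu> \<mu>] by (simp add: mn_density_exp[OF S] Z_def)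
  have "mn_density \<mu> \<Sigma> x \<le> (1 / Z) * exp (- (norm (x - \<mu>) / c)\<^sup>2 / 2)" for x
  proof -
    have "norm v / c \<le> norm (mat_isqrt \<Sigma> *v v)" for v
      using c(2)[of "mat_isqrt \<Sigma> *v v"] c(1) by (simp add: mat_sqrt_mult_isqrt[OF S] field_simps)
    hence "(\<Sum>i\<in>UNIV. (norm (x $ i - \<mu> $ i) / c)\<^sup>2) \<le> (\<Sum>i\<in>UNIV. (norm (mat_isqrt \<Sigma> *v (x $ i - \<mu> $ i)))\<^sup>2)"
      using c(1) by (intro sum_mono power_mono) auto
    moreover have "(\<Sum>i\<in>UNIV. (norm (x $ i - \<mu> $ i) / c)\<^sup>2) = (norm (x - \<mu>) / c)\<^sup>2"
      by (simp add: power_divide power2_norm_vec[of "x - \<mu>"] sum_divide_distrib)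
    ultimately show ?thesis
      using \<open>Z > 0\<close> unfolding mn_density_exp[OF S] Z_def[symmetric] by (simp add: divide_right_mono)
  qed
  hence "(\<integral>\<^sup>+x. ennreal (mn_density \<mu> \<Sigma> x) \<partial>lborel) \<le>
      (\<integral>\<^sup>+x. ennreal (1 / Z) * ennreal (exp (- (norm (x - \<mu>) / c)\<^sup>2 / 2)) \<partial>lborel)"
    using \<open>Z > 0\<close> by (intro nn_integral_mono) (simp add: ennreal_leI flip: ennreal_mult)
  also have "\<dots> = ennreal (1 / Z) * (\<integral>\<^sup>+x. ennreal (exp (- (norm (x - \<mu>) / c)\<^sup>2 / 2)) \<partial>lborel)"
    by (rule nn_integral_cmult) measurable
  also have "\<dots> < \<infinity>"
    using nn_integral_gaussian_finite[OF c(1), of \<mu>] by (simp add: ennreal_mult_less_top)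
  finally show ?thesis .
qed

subsection \<open>Clusterings and selection probabilities\<close>

lemma valid_history_snoc:
  "valid_history (ms @ [M]) \<longleftrightarrow> valid_history ms \<and> M \<in> cands ms"
  by (auto simp: valid_history_def nth_append less_Suc_eq)

text \<open>Singletons are nonempty, and merging keeps clusters nonempty. This feeds
  \<open>contrast_nonzero\<close> for the final merge.\<close>

lemma clusters_after_nonempty:
  "valid_history ms \<Longrightarrow> A \<in> clusters_after ms \<Longrightarrow> A \<noteq> {}"
proof (induction ms arbitrary: A rule: rev_induct)
  case Nil
  thus ?case by (auto simp: clusters_after_def)
next
  case (snoc M ms)
  have "clusters_after (ms @ [M]) = (clusters_after ms - M) \<union> {\<Union>M}"
    by (simp add: clusters_after_def)
  with snoc show ?case by (auto simp: valid_history_snoc cands_def)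
qed

lemma contrast_nonzero:
  assumes "C1 \<noteq> C2" "C1 \<noteq> {}" "C2 \<noteq> {}"
  shows "contrast C1 C2 \<noteq> (0 :: real^'n)"
proof
  assume "contrast C1 C2 = (0 :: real^'n)"
  hence "(if i \<in> C1 then 1 / real (card C1) else 0) = (if i \<in> C2 then 1 / real (card C2) else 0)" for i
    by (simp add: contrast_def vec_eq_iff)
  hence "i \<in> C1 \<longleftrightarrow> i \<in> C2" for i
    using assms(2,3) by (metis card_eq_0_iff divide_eq_0_iff finite of_nat_eq_0_iff zero_neq_one)
  thus False using assms(1) by blast
qed

text \<open>With the rows of \<mu> for x, the right side is the difference of the cluster means;
  this turns the null hypothesis into the vanishing of \<open>outer_coord\<close> at \<mu>.\<close>

lemma sum_contrast_scaleR:
  fixes x :: "'n::finite \<Rightarrow> 'a::real_vector"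
  shows "(\<Sum>i\<in>UNIV. contrast C1 C2 $ i *\<^sub>R x i) =
    (1 / real (card C1)) *\<^sub>R (\<Sum>i\<in>C1. x i) - (1 / real (card C2)) *\<^sub>R (\<Sum>i\<in>C2. x i)"
  by (simp add: contrast_def scaleR_diff_left sum_subtractf scaleR_sum_right if_distrib[of "\<lambda>c. c *\<^sub>R _"]
      sum.If_cases cong: if_cong)

lemma step_prob_le_1: "step_prob d \<tau> ms M x \<le> 1"
proof (cases "M \<in> cands ms")
  case True
  have "exp (- d M x / temp d \<tau> ms x) \<le> (\<Sum>M'\<in>cands ms. exp (- d M' x / temp d \<tau> ms x))"
    using True by (intro member_le_sum) auto
  moreover have "\<dots> > 0" using True by (intro sum_pos) auto
  ultimately show ?thesis by (simp add: step_prob_def divide_le_eq_1)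
qed (simp add: step_prob_def)

lemma step_prob_nonneg: "step_prob d \<tau> ms M x \<ge> 0"
  by (simp add: step_prob_def sum_nonneg)

text \<open>Exponential weights are positive at every temperature. Where all dissimilarities vanish,
  \<open>temp\<close> is 0, the quotient is 0 by convention and each weight is exp 0 = 1.\<close>

lemma step_prob_pos: "M \<in> cands ms \<Longrightarrow> step_prob d \<tau> ms M x > 0"
  by (auto simp: step_prob_def intro!: divide_pos_pos sum_pos)

lemma seq_prob_le_1: "seq_prob d \<tau> ms x \<le> 1"
  by (simp add: seq_prob_def prod_le_1 step_prob_nonneg step_prob_le_1)

lemma seq_prob_nonneg: "seq_prob d \<tau> ms x \<ge> 0"
  by (simp add: seq_prob_def prod_nonneg step_prob_nonneg)

text \<open>No data value rules out a valid history. Hence the weight on a ray is strictly positive,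
  and so is the mass of the conditioning event.\<close>

lemma seq_prob_pos: "valid_history ms \<Longrightarrow> seq_prob d \<tau> ms x > 0"
  by (auto simp: seq_prob_def valid_history_def intro!: prod_pos step_prob_pos)

lemma measurable_seq_prob:
  assumes [measurable]: "\<And>M. d M \<in> borel_measurable borel"
  shows "seq_prob d \<tau> ms \<in> borel_measurable borel"
proof -
  have "(\<lambda>x. step_prob d \<tau> ms' M x) \<in> borel_measurable borel" for ms' M
    unfolding step_prob_def temp_def by measurable
  thus ?thesis unfolding seq_prob_def by measurable
qed

subsection \<open>The statistics along a ray\<close>

definition outer :: "real^'n \<Rightarrow> real^'p \<Rightarrow> real^'p^'n" where
  "outer \<nu> w = (\<chi> i. \<nu> $ i *\<^sub>R w)"

text \<open>For nonzero \<nu>, the row w such that \<open>outer \<nu> w\<close> is the orthogonal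
  projection of x onto the matrices of this form.\<close>

definition outer_coord :: "real^'n \<Rightarrow> real^'p^'n \<Rightarrow> real^'p" where
  "outer_coord \<nu> x = (1 / (norm \<nu>)\<^sup>2) *\<^sub>R (\<Sum>i\<in>UNIV. \<nu> $ i *\<^sub>R x $ i)"

lemma outer_add: "outer \<nu> (v + w) = outer \<nu> v + outer \<nu> w"
  by (simp add: outer_def vec_eq_iff algebra_simps)

lemma outer_coord_add_outer:
  assumes "\<nu> \<noteq> 0" shows "outer_coord \<nu> (x + outer \<nu> w) = outer_coord \<nu> x + w"
proof -
  have "(\<Sum>i\<in>UNIV. \<nu> $ i *\<^sub>R (x + outer \<nu> w) $ i) = (\<Sum>i\<in>UNIV. \<nu> $ i *\<^sub>R x $ i) + (norm \<nu>)\<^sup>2 *\<^sub>R w"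
    by (simp add: outer_def power2_norm_vec[of \<nu>] scaleR_add_right sum.distrib scaleR_sum_left)
      (simp add: power2_eq_square)
  thus ?thesis using assms by (simp add: outer_coord_def scaleR_add_right)
qed

lemma continuous_on_outer: "continuous_on A (outer \<nu>)"
  unfolding outer_def by (intro continuous_intros)

lemma continuous_on_outer_coord: "continuous_on A (outer_coord \<nu>)"
  unfolding outer_coord_def by (intro continuous_intros)

lemma transpose_mult_outer_coord:
  assumes "\<nu> \<noteq> 0" shows "transpose x *v \<nu> = (norm \<nu>)\<^sup>2 *\<^sub>R outer_coord \<nu> x"
  using assms by (simp add: vec_eq_iff vector_matrix_mult_def outer_coord_def mult.commute)

lemma stat_vec_outer_coord:
  assumes "\<nu> \<noteq> 0"
  shows "stat_vec \<Sigma> \<nu> x = (norm \<nu>)\<^sup>2 *\<^sub>R (mat_isqrt \<Sigma> *v outer_coord \<nu> x)"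
  by (simp add: stat_vec_def transpose_mult_outer_coord[OF assms] matrix_vector_mult_scaleR del: transpose_matrix_vector)

lemma statPi_outer_coord:
  assumes "\<nu> \<noteq> 0" shows "statPi \<nu> x = x - outer \<nu> (outer_coord \<nu> x)"
proof -
  have "statPi \<nu> x $ i $ j = (x - outer \<nu> (outer_coord \<nu> x)) $ i $ j" for i j
  proof -
    have "statPi \<nu> x $ i $ j = (\<Sum>k\<in>UNIV. (mat 1 $ i $ k - \<nu> $ i * \<nu> $ k / (norm \<nu>)\<^sup>2) * x $ k $ j)"
      by (simp add: statPi_def matrix_matrix_mult_def)
    also have "\<dots> = (\<Sum>k\<in>UNIV. mat 1 $ i $ k * x $ k $ j) - \<nu> $ i / (norm \<nu>)\<^sup>2 * (\<Sum>k\<in>UNIV. \<nu> $ k * x $ k $ j)"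
      by (simp add: left_diff_distrib sum_subtractf sum_distrib_left mult.assoc)
    also have "(\<Sum>k\<in>UNIV. mat 1 $ i $ k * x $ k $ j) = x $ i $ j"
      by (simp add: mat_def if_distrib[of "\<lambda>c. c * _"] cong: if_cong)
    finally show ?thesis by (simp add: outer_def outer_coord_def)
  qed
  thus ?thesis by (simp add: vec_eq_iff)
qed

lemma recon_outer:
  assumes "pos_def \<Sigma>"
  shows "recon \<Sigma> \<nu> u a = snd a + outer \<nu> ((u / (norm \<nu>)\<^sup>2) *\<^sub>R (mat_sqrt \<Sigma> *v fst a))"
proof -
  have "transpose (mat_sqrt \<Sigma>) = mat_sqrt \<Sigma>"
    using pos_def_mat_sqrt[OF assms] by (simp add: pos_def_def sym_mat_def)
  hence "fst a v* mat_sqrt \<Sigma> = mat_sqrt \<Sigma> *v fst a" by (metis transpose_matrix_vector)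
  thus ?thesis by (simp add: recon_def outer_def vec_eq_iff algebra_simps)
qed

text \<open>Along the ray \<open>stat_vec\<close> is s times a fixed nonzero vector, so s enters
  only through its length, while direction and residual stay fixed. \<open>recon\<close> undoes the
  split of a data matrix into U and the ancillary statistic.\<close>

lemma
  assumes S: "pos_def \<Sigma>" and \<nu>: "\<nu> \<noteq> 0" and \<pi>: "outer_coord \<nu> \<pi> = 0" and w: "w \<noteq> 0" and s: "s > 0"
  shows statU_on_ray: "statU \<Sigma> \<nu> (\<pi> + outer \<nu> (s *\<^sub>R w)) = s * statU \<Sigma> \<nu> (\<pi> + outer \<nu> w)"
    and statU_pos: "statU \<Sigma> \<nu> (\<pi> + outer \<nu> w) > 0"
    and ancillary_on_ray: "ancillary \<Sigma> \<nu> (\<pi> + outer \<nu> (s *\<^sub>R w)) = ancillary \<Sigma> \<nu> (\<pi> + outer \<nu> w)"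
    and recon_on_ray: "recon \<Sigma> \<nu> (s * statU \<Sigma> \<nu> (\<pi> + outer \<nu> w)) (ancillary \<Sigma> \<nu> (\<pi> + outer \<nu> w)) =
      \<pi> + outer \<nu> (s *\<^sub>R w)"
proof -
  let ?T = "mat_isqrt \<Sigma>"
  have T: "?T *v w \<noteq> 0"
    using w mat_sqrt_mult_isqrt(1)[OF S, of w] by auto
  have vec: "stat_vec \<Sigma> \<nu> (\<pi> + outer \<nu> (s' *\<^sub>R w)) = ((norm \<nu>)\<^sup>2 * s') *\<^sub>R (?T *v w)" for s'
    by (simp add: stat_vec_outer_coord[OF \<nu>] outer_coord_add_outer[OF \<nu>] \<pi> matrix_vector_mult_scaleR)
  have U: "statU \<Sigma> \<nu> (\<pi> + outer \<nu> (s' *\<^sub>R w)) = s' * ((norm \<nu>)\<^sup>2 * norm (?T *v w))" if "s' > 0" for s'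
    using that by (simp add: statU_def vec abs_mult)
  have Xi: "statXi \<Sigma> \<nu> (\<pi> + outer \<nu> (s' *\<^sub>R w)) = (1 / norm (?T *v w)) *\<^sub>R (?T *v w)" if "s' > 0" for s'
    using that \<nu> by (simp add: statXi_def vec abs_mult)
  have Pi: "statPi \<nu> (\<pi> + outer \<nu> w') = \<pi>" for w'
    by (simp add: statPi_outer_coord[OF \<nu>] outer_coord_add_outer[OF \<nu>] \<pi>)
  show "statU \<Sigma> \<nu> (\<pi> + outer \<nu> (s *\<^sub>R w)) = s * statU \<Sigma> \<nu> (\<pi> + outer \<nu> w)"
    using U[OF s] U[of 1] by simp
  show "statU \<Sigma> \<nu> (\<pi> + outer \<nu> w) > 0"
    using U[of 1] T \<nu> by simp
  show anc: "ancillary \<Sigma> \<nu> (\<pi> + outer \<nu> (s *\<^sub>R w)) = ancillary \<Sigma> \<nu> (\<pi> + outer \<nu> w)"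
    using Xi[OF s] Xi[of 1] by (simp add: ancillary_def Pi)
  show "recon \<Sigma> \<nu> (s * statU \<Sigma> \<nu> (\<pi> + outer \<nu> w)) (ancillary \<Sigma> \<nu> (\<pi> + outer \<nu> w)) =
      \<pi> + outer \<nu> (s *\<^sub>R w)"
    using U[of 1] Xi[of 1] T \<nu>
    by (simp add: recon_outer[OF S] ancillary_def Pi matrix_vector_mult_scaleR mat_sqrt_mult_isqrt[OF S])
qed

text \<open>Pythagoras, row by row: the cross terms sum to zero because the \<nu>-weighted sums of
  the rows of \<pi> and of \<mu> both vanish. This is where the null hypothesis enters. Dividing U
  by |\<nu>| matches the scale of the chi density.\<close>

lemma mn_density_on_fibre:
  fixes \<mu> \<pi> :: "real^'p^'n"
  assumes S: "pos_def \<Sigma>" and \<nu>: "\<nu> \<noteq> 0" and \<pi>: "outer_coord \<nu> \<pi> = 0" and \<mu>: "outer_coord \<nu> \<mu> = 0"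
  shows "mn_density \<mu> \<Sigma> (\<pi> + outer \<nu> w) =
    mn_density \<mu> \<Sigma> \<pi> * exp (- (statU \<Sigma> \<nu> (\<pi> + outer \<nu> w) / norm \<nu>)\<^sup>2 / 2)"
proof -
  let ?T = "mat_isqrt \<Sigma>"
  have U: "statU \<Sigma> \<nu> (\<pi> + outer \<nu> w) / norm \<nu> = norm \<nu> * norm (?T *v w)"
    using \<nu> by (simp add: statU_def stat_vec_outer_coord[OF \<nu>] outer_coord_add_outer[OF \<nu>] \<pi> power2_eq_square)
  have "(\<Sum>i\<in>UNIV. \<nu> $ i *\<^sub>R (\<pi> $ i - \<mu> $ i)) = 0"
    using \<pi> \<mu> \<nu> by (simp add: outer_coord_def scaleR_diff_right sum_subtractf)
  hence "(?T *v (\<Sum>i\<in>UNIV. \<nu> $ i *\<^sub>R (\<pi> $ i - \<mu> $ i))) \<bullet> (?T *v w) = 0" by simp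
  hence cross: "(\<Sum>i\<in>UNIV. \<nu> $ i * ((?T *v (\<pi> $ i - \<mu> $ i)) \<bullet> (?T *v w))) = 0"
    by (simp add: linear_sum[OF matrix_vector_mul_linear] inner_sum_left matrix_vector_mult_scaleR o_def)
  have "(norm (?T *v ((\<pi> + outer \<nu> w) $ i - \<mu> $ i)))\<^sup>2 = (norm (?T *v (\<pi> $ i - \<mu> $ i)))\<^sup>2
      + 2 * (\<nu> $ i * ((?T *v (\<pi> $ i - \<mu> $ i)) \<bullet> (?T *v w))) + (\<nu> $ i)\<^sup>2 * (norm (?T *v w))\<^sup>2" for i
  proof -
    have eq: "?T *v ((\<pi> + outer \<nu> w) $ i - \<mu> $ i) = ?T *v (\<pi> $ i - \<mu> $ i) + \<nu> $ i *\<^sub>R (?T *v w)"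
      by (simp add: outer_def algebra_simps)
    show ?thesis unfolding eq power2_norm_eq_inner
      by (simp add: inner_add_left inner_add_right inner_commute[of "?T *v w" "?T *v (\<pi> $ i - \<mu> $ i)"] power2_eq_square distrib_left)
  qed
  hence "(\<Sum>i\<in>UNIV. (norm (?T *v ((\<pi> + outer \<nu> w) $ i - \<mu> $ i)))\<^sup>2) =
      (\<Sum>i\<in>UNIV. (norm (?T *v (\<pi> $ i - \<mu> $ i)))\<^sup>2) + (norm \<nu> * norm (?T *v w))\<^sup>2"
    by (simp only: sum.distrib cross power_mult_distrib power2_norm_vec[of \<nu>] flip: sum_distrib_left sum_distrib_right)
      simp
  moreover have "exp (- (a + b) / 2) / c = exp (- a / 2) / c * exp (- b / 2)" for a b c :: real
    by (simp add: mult_exp_exp diff_divide_distrib)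
  ultimately show ?thesis unfolding U mn_density_exp[OF S] by (simp only:)
qed

subsection \<open>The selective p-value\<close>

lemma measurable_seq_prob_recon:
  assumes S: "pos_def \<Sigma>" and d: "\<And>M. d M \<in> borel_measurable borel"
  shows "(\<lambda>(u, a). seq_prob d \<tau> m (recon \<Sigma> \<nu> u a)) \<in> borel_measurable (borel \<Otimes>\<^sub>M borel)"
proof -
  have "continuous_on UNIV (\<lambda>(u, a). recon \<Sigma> \<nu> u a)"
    unfolding recon_outer[OF S] case_prod_beta divide_inverse
    by (intro continuous_on_add continuous_on_compose2[OF continuous_on_outer[of UNIV]] continuous_intros
        bounded_linear.continuous_on[OF matrix_vector_mul_bounded_linear]) auto
  hence recon: "(\<lambda>(u, a). recon \<Sigma> \<nu> u a) \<in> borel_measurable (borel \<Otimes>\<^sub>M borel)"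
    unfolding borel_prod by (rule borel_measurable_continuous_onI)
  show ?thesis
    using measurable_compose[OF recon measurable_seq_prob[of d \<tau> m, OF d]] by (simp add: case_prod_beta)
qed

lemma measurable_selCDF:
  fixes \<Sigma> :: "real^'p^'p"
  assumes S: "pos_def \<Sigma>" and d: "\<And>M. d M \<in> borel_measurable borel"
  shows "(\<lambda>(u, a). selCDF \<Sigma> d \<tau> \<nu> m u a) \<in> borel_measurable (borel \<Otimes>\<^sub>M borel)"
proof -
  define q where "q = (\<lambda>u a. seq_prob d \<tau> m (recon \<Sigma> \<nu> u a))"
  have q: "(\<lambda>(u, a). q u a) \<in> borel_measurable (borel \<Otimes>\<^sub>M borel)"
    unfolding q_def by (rule measurable_seq_prob_recon[OF S d])
  have "(\<lambda>x. (snd x, snd (fst x))) \<in> measurable ((borel \<Otimes>\<^sub>M borel) \<Otimes>\<^sub>M lborel) (borel \<Otimes>\<^sub>M borel)"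
    by measurable
  from measurable_compose[OF this q]
  have [measurable]: "(\<lambda>x. q (snd x) (snd (fst x))) \<in> borel_measurable ((borel \<Otimes>\<^sub>M borel) \<Otimes>\<^sub>M lborel)"
    by simp
  \<comment> \<open>As an \<open>if\<close> in the integrand, the domain depending on u becomes an
    integral over the whole line, whose measurability in the parameters (u, a) is standard.\<close>
  have "selCDF \<Sigma> d \<tau> \<nu> m u a =
      (\<integral>v. (if 0 \<le> v \<and> v \<le> u then scaled_chi_density (norm \<nu>) CARD('p) v * q v a else 0) \<partial>lborel) /
      (\<integral>v. (if 0 \<le> v then scaled_chi_density (norm \<nu>) CARD('p) v * q v a else 0) \<partial>lborel)" for u a
    unfolding selCDF_def Let_def set_lebesgue_integral_def q_def
    by (intro arg_cong2[of _ _ _ _ "(/)"] Bochner_Integration.integral_cong refl) (auto simp: indicator_def)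
  thus ?thesis by (simp add: case_prod_beta) measurable
qed

lemma measurable_sel_pvalue:
  assumes S: "pos_def \<Sigma>" and d: "\<And>M. d M \<in> borel_measurable borel" and \<nu>: "contrast C1 C2 \<noteq> 0"
  shows "sel_pvalue \<Sigma> d \<tau> C1 C2 m \<in> borel_measurable borel"
proof -
  let ?\<nu> = "contrast C1 C2"
  have "continuous_on UNIV (stat_vec \<Sigma> ?\<nu>)"
    unfolding stat_vec_outer_coord[OF \<nu>, abs_def]
    by (intro continuous_intros bounded_linear.continuous_on[OF matrix_vector_mul_bounded_linear] continuous_on_outer_coord)
  hence [measurable]: "stat_vec \<Sigma> ?\<nu> \<in> borel_measurable borel"
    by (rule borel_measurable_continuous_onI)
  have "continuous_on UNIV (statPi ?\<nu>)"
    unfolding statPi_outer_coord[OF \<nu>, abs_def]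
    by (intro continuous_intros continuous_on_compose2[OF continuous_on_outer[of UNIV]] continuous_on_outer_coord) auto
  hence [measurable]: "statPi ?\<nu> \<in> borel_measurable borel"
    by (rule borel_measurable_continuous_onI)
  have [measurable]: "statU \<Sigma> ?\<nu> \<in> borel_measurable borel"
    unfolding statU_def by measurable
  have [measurable]: "ancillary \<Sigma> ?\<nu> \<in> borel_measurable borel"
    unfolding ancillary_def statXi_def by measurable
  have "(\<lambda>x. (statU \<Sigma> ?\<nu> x, ancillary \<Sigma> ?\<nu> x)) \<in> measurable borel (borel \<Otimes>\<^sub>M borel)"
    by measurable
  from measurable_compose[OF this measurable_selCDF[OF S d]] show ?thesis
    unfolding sel_pvalue_def by simp
qed

text \<open>With r the value of U at s = 1, the weighted density on the ray is K g (r s) and the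
  p-value is 1 - F (r s), where g is the integrand of the selective CDF at the common ancillary
  value and K is free of s. Substituting u = r s leads to
  \<open>nn_integral_upper_tail\<close>.\<close>

lemma nn_integral_ray_tail:
  fixes \<mu> \<pi> :: "real^'p^'n" and \<tau> :: real
  assumes S: "pos_def \<Sigma>" and d: "\<And>M. d M \<in> borel_measurable borel" and m: "valid_history m"
    and \<nu>: "contrast C1 C2 \<noteq> 0" and \<pi>: "outer_coord (contrast C1 C2) \<pi> = 0"
    and \<mu>: "outer_coord (contrast C1 C2) \<mu> = 0" and w: "w \<noteq> 0" and \<alpha>: "0 \<le> \<alpha>" "\<alpha> \<le> 1"
  defines "f \<equiv> \<lambda>x. mn_density \<mu> \<Sigma> x * seq_prob d \<tau> m x"
    and "ray \<equiv> \<lambda>s. \<pi> + outer (contrast C1 C2) (s *\<^sub>R w)"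
  shows "(\<integral>\<^sup>+s. ennreal (s ^ (CARD('p) - 1)) *
        (ennreal (f (ray s)) * indicator {x. sel_pvalue \<Sigma> d \<tau> C1 C2 m x \<le> \<alpha>} (ray s)) * indicator {0<..} s \<partial>lborel) =
      ennreal \<alpha> * (\<integral>\<^sup>+s. ennreal (s ^ (CARD('p) - 1)) * ennreal (f (ray s)) * indicator {0<..} s \<partial>lborel)"
proof -
  define \<nu>' where "\<nu>' = contrast C1 C2"
  note \<nu> = \<nu>[folded \<nu>'_def] and \<pi> = \<pi>[folded \<nu>'_def] and \<mu> = \<mu>[folded \<nu>'_def]
  define r where "r = statU \<Sigma> \<nu>' (\<pi> + outer \<nu>' w)"
  define a where "a = ancillary \<Sigma> \<nu>' (\<pi> + outer \<nu>' w)"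
  define g where "g = (\<lambda>u. scaled_chi_density (norm \<nu>') CARD('p) u * seq_prob d \<tau> m (recon \<Sigma> \<nu>' u a))"
  define F where "F = (\<lambda>u. set_lebesgue_integral lborel {0..u} g / set_lebesgue_integral lborel {0..} g)"
  have selCDF: "selCDF \<Sigma> d \<tau> \<nu>' m u a = F u" for u
    by (simp add: selCDF_def F_def g_def Let_def)
  have r: "r > 0" unfolding r_def by (rule statU_pos[OF S \<nu> \<pi> w zero_less_one])
  obtain Z where Z: "Z > 0" "\<And>u. u > 0 \<Longrightarrow>
      scaled_chi_density (norm \<nu>') CARD('p) u = Z * (u ^ (CARD('p) - 1) * exp (- (u / norm \<nu>')\<^sup>2 / 2))"
    using scaled_chi_density_gaussian[of "norm \<nu>'" "CARD('p)"] \<nu> by auto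
  have Pair_a: "(\<lambda>u. (u, a)) \<in> measurable borel (borel \<Otimes>\<^sub>M borel)" by measurable
  have [measurable]: "F \<in> borel_measurable borel"
    using measurable_compose[OF Pair_a measurable_selCDF[of \<Sigma> d \<tau> \<nu>' m, OF S d]] by (simp add: selCDF)
  have [measurable]: "g \<in> borel_measurable borel"
    using measurable_compose[OF Pair_a measurable_seq_prob_recon[of \<Sigma> d \<tau> m \<nu>', OF S d]] by (simp add: g_def)
  have g_pos: "g u > 0" if "u > 0" for u
    unfolding g_def Z(2)[OF that] using that Z(1) by (intro mult_pos_pos seq_prob_pos[OF m]) auto
  have g_int: "set_integrable lborel {0..} g"
  proof -
    have "integrable lborel g"
    proof (rule Bochner_Integration.integrable_bound)
      show "integrable lborel (scaled_chi_density (norm \<nu>') CARD('p))"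
        using \<nu> by (intro integrable_scaled_chi_density) auto
      have "norm (g u) \<le> norm (scaled_chi_density (norm \<nu>') CARD('p) u)" for u
        using seq_prob_nonneg[of d \<tau> m "recon \<Sigma> \<nu>' u a"] seq_prob_le_1[of d \<tau> m "recon \<Sigma> \<nu>' u a"]
        by (simp add: g_def abs_mult mult_left_le)
      thus "AE u in lborel. norm (g u) \<le> norm (scaled_chi_density (norm \<nu>') CARD('p) u)" by simp
    qed measurable
    thus ?thesis using integrable_mult_indicator[of "{0..}" lborel g] by (simp add: set_integrable_def)
  qed
  \<comment> \<open>The part of the density free of s, divided by what g (r s) has in excess: Z from
    the chi density, and a power of r because g carries the power p - 1 of r s instead of s.\<close>
  define K where "K = mn_density \<mu> \<Sigma> \<pi> / (Z * r ^ (CARD('p) - 1))"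
  have "K > 0" using mn_density_pos[OF S, of \<mu> \<pi>] Z(1) r by (simp add: K_def)
  have ray: "s ^ (CARD('p) - 1) * f (ray s) = K * g (r * s)"
    and pval: "sel_pvalue \<Sigma> d \<tau> C1 C2 m (ray s) = 1 - F (r * s)" if s: "s > 0" for s
  proof -
    have U: "statU \<Sigma> \<nu>' (ray s) = r * s"
      using statU_on_ray[OF S \<nu> \<pi> w s] by (simp add: ray_def r_def \<nu>'_def mult.commute)
    have anc: "ancillary \<Sigma> \<nu>' (ray s) = a"
      using ancillary_on_ray[OF S \<nu> \<pi> w s] by (simp add: ray_def a_def \<nu>'_def)
    have rec: "recon \<Sigma> \<nu>' (r * s) a = ray s"
      using recon_on_ray[OF S \<nu> \<pi> w s] by (simp add: ray_def a_def r_def \<nu>'_def mult.commute)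
    show "sel_pvalue \<Sigma> d \<tau> C1 C2 m (ray s) = 1 - F (r * s)"
      by (simp add: sel_pvalue_def anc U selCDF flip: \<nu>'_def)
    have "f (ray s) = mn_density \<mu> \<Sigma> \<pi> * exp (- (r * s / norm \<nu>')\<^sup>2 / 2) * seq_prob d \<tau> m (ray s)"
      using mn_density_on_fibre[OF S \<nu> \<pi> \<mu>, of "s *\<^sub>R w"] U by (simp add: f_def ray_def \<nu>'_def)
    moreover have "g (r * s) = Z * ((r * s) ^ (CARD('p) - 1) * exp (- (r * s / norm \<nu>')\<^sup>2 / 2)) * seq_prob d \<tau> m (ray s)"
      using Z(2)[of "r * s"] r s by (simp add: g_def rec)
    ultimately show "s ^ (CARD('p) - 1) * f (ray s) = K * g (r * s)"
      using Z(1) r by (simp add: K_def power_mult_distrib)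
  qed
  define h1 where "h1 = (\<lambda>u. ennreal (g u) * indicator {u. 1 - F u \<le> \<alpha>} u * indicator {0<..} u)"
  define h2 where "h2 = (\<lambda>u. ennreal (g u) * indicator {0<..} u)"
  have [measurable]: "h1 \<in> borel_measurable borel" "h2 \<in> borel_measurable borel"
    unfolding h1_def h2_def by measurable
  have "(\<integral>\<^sup>+u. h1 u \<partial>lborel) = ennreal \<alpha> * (\<integral>\<^sup>+u. h2 u \<partial>lborel)"
    unfolding h1_def h2_def F_def using g_int g_pos \<alpha> by (rule nn_integral_upper_tail)
  hence "ennreal r * (\<integral>\<^sup>+s. h1 (r * s) \<partial>lborel) = ennreal r * (ennreal \<alpha> * (\<integral>\<^sup>+s. h2 (r * s) \<partial>lborel))"
    using nn_integral_lborel_scale[of h1 r] nn_integral_lborel_scale[of h2 r] r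
    by (simp add: mult.left_commute)
  hence eq: "(\<integral>\<^sup>+s. h1 (r * s) \<partial>lborel) = ennreal \<alpha> * (\<integral>\<^sup>+s. h2 (r * s) \<partial>lborel)"
    using r by (subst (asm) ennreal_mult_cancel_left) auto
  have "ennreal (s ^ (CARD('p) - 1)) *
        (ennreal (f (ray s)) * indicator {x. sel_pvalue \<Sigma> d \<tau> C1 C2 m x \<le> \<alpha>} (ray s)) * indicator {0<..} s =
      ennreal K * h1 (r * s)" (is "?l1 s = _")
    and "ennreal (s ^ (CARD('p) - 1)) * ennreal (f (ray s)) * indicator {0<..} s = ennreal K * h2 (r * s)" (is "?l2 s = _") for s
  proof -
    have "ennreal (s ^ (CARD('p) - 1)) * ennreal (f (ray s)) = ennreal K * ennreal (g (r * s))" if "s > 0"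
      using ray[OF that] that \<open>K > 0\<close> by (metis ennreal_mult' less_imp_le zero_le_power)
    thus "?l1 s = ennreal K * h1 (r * s)" "?l2 s = ennreal K * h2 (r * s)"
      using r pval[of s] by (auto simp: h1_def h2_def indicator_def zero_less_mult_iff)
  qed
  thus ?thesis by (simp add: nn_integral_cmult eq mult.left_commute)
qed

text \<open>The shell weights and the cube cutoff are the same for \<open>f\<close> and
  \<open>f'\<close>, so the factor \<alpha> found on each ray passes through both
  decompositions.\<close>

lemma nn_integral_sel_pvalue_le:
  fixes \<mu> :: "real^'p^'n" and \<tau> :: real
  assumes S: "pos_def \<Sigma>" and d: "\<And>M. d M \<in> borel_measurable borel" and m: "valid_history m"
    and \<nu>: "contrast C1 C2 \<noteq> 0" and \<mu>: "outer_coord (contrast C1 C2) \<mu> = 0" and \<alpha>: "0 \<le> \<alpha>" "\<alpha> \<le> 1"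
  defines "f \<equiv> \<lambda>x. ennreal (mn_density \<mu> \<Sigma> x * seq_prob d \<tau> m x)"
  shows "(\<integral>\<^sup>+x. f x * indicator {x. sel_pvalue \<Sigma> d \<tau> C1 C2 m x \<le> \<alpha>} x \<partial>lborel) =
    ennreal \<alpha> * (\<integral>\<^sup>+x. f x \<partial>lborel)"
proof -
  let ?L = "outer (contrast C1 C2) :: real^'p \<Rightarrow> real^'p^'n"
  let ?W = "outer_coord (contrast C1 C2) :: real^'p^'n \<Rightarrow> real^'p"
  define f' where "f' = (\<lambda>x. f x * indicator {x. sel_pvalue \<Sigma> d \<tau> C1 C2 m x \<le> \<alpha>} x)"
  note [measurable] = measurable_seq_prob[of d, OF d] measurable_sel_pvalue[OF S d \<nu>]
  have L[measurable]: "?L \<in> borel_measurable borel"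
    by (intro borel_measurable_continuous_onI continuous_on_outer)
  have W[measurable]: "?W \<in> borel_measurable borel"
    by (intro borel_measurable_continuous_onI continuous_on_outer_coord)
  have f[measurable]: "f \<in> borel_measurable borel" unfolding f_def by measurable
  have f'[measurable]: "f' \<in> borel_measurable borel" unfolding f'_def by measurable
  have W0: "?W (x - ?L (?W x)) = 0" for x
    using outer_coord_add_outer[OF \<nu>, of "x - ?L (?W x)" "?W x"] by simp
  have fibre: "(\<integral>\<^sup>+w. f' (\<pi> + ?L w) \<partial>lborel) = ennreal \<alpha> * (\<integral>\<^sup>+w. f (\<pi> + ?L w) \<partial>lborel)"
    if \<pi>: "?W \<pi> = 0" for \<pi>
  proof -
    let ?I = "\<lambda>h w. \<integral>\<^sup>+s. ennreal (s ^ (CARD('p) - 1)) * h (\<pi> + ?L (s *\<^sub>R w)) * indicator {0<..} s \<partial>lborel"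
    have "ennreal (indicator {1/2..<1} (norm w) / norm w) * ?I f' w =
        ennreal \<alpha> * (ennreal (indicator {1/2..<1} (norm w) / norm w) * ?I f w)" for w
    \<comment> \<open>The origin has no direction, but the shell indicator vanishes there.\<close>
    proof (cases "w = 0")
      case False
      have "?I f' w = ennreal \<alpha> * ?I f w"
        unfolding f'_def f_def by (rule nn_integral_ray_tail[OF S d m \<nu> \<pi> \<mu> False \<alpha>])
      thus ?thesis by (simp add: mult.left_commute)
    qed simp
    thus ?thesis
      using nn_integral_lborel_rays[of "\<lambda>w. f' (\<pi> + ?L w)"] nn_integral_lborel_rays[of "\<lambda>w. f (\<pi> + ?L w)"]
      by (simp add: nn_integral_cmult)
  qed
  have "(\<integral>\<^sup>+x. f' x \<partial>lborel) =
      (\<integral>\<^sup>+x. indicator (cbox 0 One) (?W x) * (\<integral>\<^sup>+w. f' (x - ?L (?W x) + ?L w) \<partial>lborel) \<partial>lborel)"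
    by (rule nn_integral_lborel_fibre[OF f' W L outer_coord_add_outer[OF \<nu>] outer_add])
  also have "\<dots> = (\<integral>\<^sup>+x. ennreal \<alpha> * (indicator (cbox 0 One) (?W x) * (\<integral>\<^sup>+w. f (x - ?L (?W x) + ?L w) \<partial>lborel)) \<partial>lborel)"
    by (simp add: fibre[OF W0] mult.left_commute)
  also have "\<dots> = ennreal \<alpha> * (\<integral>\<^sup>+x. indicator (cbox 0 One) (?W x) * (\<integral>\<^sup>+w. f (x - ?L (?W x) + ?L w) \<partial>lborel) \<partial>lborel)"
    by (rule nn_integral_cmult) measurable
  also have "\<dots> = ennreal \<alpha> * (\<integral>\<^sup>+x. f x \<partial>lborel)"
    by (simp add: nn_integral_lborel_fibre[OF f W L outer_coord_add_outer[OF \<nu>] outer_add])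
  finally show ?thesis unfolding f'_def .
qed

text \<open>There are finitely many histories of length t, so the inner integral is a finite sum in
  which only the term for m survives. A general P serves the numerator of the conditional
  probability and, taken constantly true, its denominator.\<close>

lemma emeasure_joint_law:
  fixes \<mu> :: "real^'p^'n"
  assumes S: "pos_def \<Sigma>" and d: "\<And>M. d M \<in> borel_measurable borel" and m: "length m = t"
    and P[measurable]: "Measurable.pred borel P"
  shows "emeasure (joint_law \<mu> \<Sigma> d \<tau> t) {\<omega> \<in> space (joint_law \<mu> \<Sigma> d \<tau> t). P (fst \<omega>) \<and> snd \<omega> = m} =
    (\<integral>\<^sup>+x. ennreal (mn_density \<mu> \<Sigma> x * seq_prob d \<tau> m x) * indicator {x. P x} x \<partial>lborel)"
proof -
  let ?H = "{ms :: 'n set set list. length ms = t}"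
  let ?N = "matrix_normal \<mu> \<Sigma>"
  let ?A = "{\<omega> \<in> space (joint_law \<mu> \<Sigma> d \<tau> t). P (fst \<omega>) \<and> snd \<omega> = m}"
  have fin: "finite ?H" using finite_lists_length_eq[of "UNIV :: 'n set set set" t] by simp
  interpret H: sigma_finite_measure "count_space ?H"
    by (rule sigma_finite_measure_count_space_finite[OF fin])
  have [measurable_cong]: "sets ?N = sets borel" by (simp add: matrix_normal_def)
  note [measurable] = measurable_seq_prob[of d, OF d]
  have seq[measurable]: "(\<lambda>(x, ms). ennreal (seq_prob d \<tau> ms x)) \<in> borel_measurable (?N \<Otimes>\<^sub>M count_space ?H)"
  proof -
    have "(\<lambda>\<omega>. (\<lambda>ms \<omega>. ennreal (seq_prob d \<tau> ms (fst \<omega>))) (snd \<omega>) \<omega>)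
        \<in> borel_measurable (?N \<Otimes>\<^sub>M count_space ?H)"
    proof (rule measurable_compose_countable'[where I = ?H])
      show "(\<lambda>\<omega>. ennreal (seq_prob d \<tau> ms (fst \<omega>))) \<in> borel_measurable (?N \<Otimes>\<^sub>M count_space ?H)" for ms
        by measurable
    qed (use fin in \<open>auto intro: countable_finite\<close>)
    thus ?thesis by (simp add: case_prod_beta)
  qed
  have space_J: "space (joint_law \<mu> \<Sigma> d \<tau> t) = UNIV \<times> ?H"
    by (simp add: joint_law_def space_pair_measure matrix_normal_def)
  have A: "?A = {x. P x} \<times> {m}"
    unfolding space_J set_eq_iff mem_Collect_eq mem_Times_iff singleton_iff using m by blast
  have A_sets: "?A \<in> sets (?N \<Otimes>\<^sub>M count_space ?H)"
    unfolding A using m by (intro pair_measureI) auto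
  have "emeasure (joint_law \<mu> \<Sigma> d \<tau> t) ?A =
      (\<integral>\<^sup>+\<omega>. (case \<omega> of (x, ms) \<Rightarrow> ennreal (seq_prob d \<tau> ms x)) * indicator ?A \<omega> \<partial>(?N \<Otimes>\<^sub>M count_space ?H))"
    unfolding joint_law_def by (rule emeasure_density) (use seq A_sets in \<open>simp_all add: joint_law_def\<close>)
  also have "\<dots> = (\<integral>\<^sup>+x. (\<integral>\<^sup>+ms. ennreal (seq_prob d \<tau> ms x) * indicator ?A (x, ms) \<partial>count_space ?H) \<partial>?N)"
    by (subst H.nn_integral_fst[symmetric]) (use A_sets in auto)
  also have "\<dots> = (\<integral>\<^sup>+x. ennreal (seq_prob d \<tau> m x) * indicator {x. P x} x \<partial>?N)"
  proof (rule nn_integral_cong)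
    fix x
    have "(\<integral>\<^sup>+ms. ennreal (seq_prob d \<tau> ms x) * indicator ?A (x, ms) \<partial>count_space ?H) =
        (\<Sum>ms\<in>?H. ennreal (seq_prob d \<tau> ms x) * indicator ?A (x, ms))"
      using fin by (rule nn_integral_count_space_finite)
    also have "\<dots> = (\<Sum>ms\<in>?H. if ms = m then ennreal (seq_prob d \<tau> m x) * indicator {x. P x} x else 0)"
      unfolding A by (intro sum.cong) (auto simp: indicator_def)
    also have "\<dots> = ennreal (seq_prob d \<tau> m x) * indicator {x. P x} x"
      using fin m by simp
    finally show "(\<integral>\<^sup>+ms. ennreal (seq_prob d \<tau> ms x) * indicator ?A (x, ms) \<partial>count_space ?H) = \<dots>" .
  qed
  also have "\<dots> = (\<integral>\<^sup>+x. ennreal (mn_density \<mu> \<Sigma> x) * (ennreal (seq_prob d \<tau> m x) * indicator {x. P x} x) \<partial>lborel)"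
    unfolding matrix_normal_def by (rule nn_integral_density) measurable
  also have "\<dots> = (\<integral>\<^sup>+x. ennreal (mn_density \<mu> \<Sigma> x * seq_prob d \<tau> m x) * indicator {x. P x} x \<partial>lborel)"
    by (simp add: ennreal_mult seq_prob_nonneg less_imp_le[OF mn_density_pos[OF S]] mult.assoc)
  finally show ?thesis .
qed

theorem theorem5:
  fixes \<mu> :: "real^'p^'n" and \<Sigma> :: "real^'p^'p"
    and d :: "'n set set \<Rightarrow> real^'p^'n \<Rightarrow> real" and \<tau> :: real
    and t :: nat and m :: "'n set set list" and C1 C2 :: "'n set" and \<alpha> :: real
  assumes "pos_def \<Sigma>"
    and "\<tau> > 0"
    and "\<And>M x. d M x \<ge> 0"
    and "\<And>M. d M \<in> borel_measurable borel"
    and "t \<ge> 1" and "length m = t" and "valid_history m"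
    and "m ! (t - 1) = {C1, C2}" and "C1 \<noteq> C2"
    and H0: "(1 / real (card C1)) *\<^sub>R (\<Sum>i\<in>C1. \<mu> $ i) = (1 / real (card C2)) *\<^sub>R (\<Sum>i\<in>C2. \<mu> $ i)"
    and "0 \<le> \<alpha>" and "\<alpha> \<le> 1"
  shows "cond_prob (joint_law \<mu> \<Sigma> d \<tau> t)
           (\<lambda>\<omega>. sel_pvalue \<Sigma> d \<tau> C1 C2 m (fst \<omega>) \<le> \<alpha>) (\<lambda>\<omega>. snd \<omega> = m) = \<alpha>"
proof -
  have "C1 \<noteq> {} \<and> C2 \<noteq> {}"
  proof -
    \<comment> \<open>Lists are indexed from 0, so merge number t is \<open>m ! (t - 1)\<close>, and
      its candidates are determined by the prefix of length t - 1.\<close>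
    have m: "m = take (t - 1) m @ [{C1, C2}]"
      using assms(5,6,8) by (metis One_nat_def Suc_diff_1 less_eq_Suc_le lessI order.refl take_Suc_conv_app_nth take_all)
    hence "valid_history (take (t - 1) m)" "{C1, C2} \<in> cands (take (t - 1) m)"
      using \<open>valid_history m\<close> valid_history_snoc by metis+
    moreover from this(2) have "C1 \<in> clusters_after (take (t - 1) m)" "C2 \<in> clusters_after (take (t - 1) m)"
      by (auto simp: cands_def doubleton_eq_iff)
    ultimately show ?thesis using clusters_after_nonempty by metis
  qed
  hence \<nu>: "contrast C1 C2 \<noteq> 0" using \<open>C1 \<noteq> C2\<close> contrast_nonzero by metis
  have \<mu>: "outer_coord (contrast C1 C2) \<mu> = 0"
    using H0 by (simp add: outer_coord_def sum_contrast_scaleR)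
  note S = assms(1) and d = assms(4)
  define J where "J = joint_law \<mu> \<Sigma> d \<tau> t"
  define f where "f = (\<lambda>x. mn_density \<mu> \<Sigma> x * seq_prob d \<tau> m x)"
  define D where "D = (\<integral>\<^sup>+x. ennreal (f x) \<partial>lborel)"
  note [measurable] = measurable_seq_prob[of d, OF d] measurable_sel_pvalue[OF S d \<nu>]
  have f_pos: "f x > 0" for x
    unfolding f_def by (intro mult_pos_pos mn_density_pos[OF S] seq_prob_pos[OF \<open>valid_history m\<close>])
  \<comment> \<open>\<open>D\<close> is the mass of the conditioning event. It cancels in the
    quotient only if it is finite and nonzero, since \<open>enn2real\<close> sends infinity to 0 and
    division by 0 gives 0.\<close>
  have "D < \<infinity>"
  proof -
    have "D \<le> (\<integral>\<^sup>+x. ennreal (mn_density \<mu> \<Sigma> x) \<partial>lborel)"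
      unfolding D_def f_def
      by (intro nn_integral_mono ennreal_leI mult_left_le seq_prob_le_1 less_imp_le[OF mn_density_pos[OF S]])
    thus ?thesis using nn_integral_mn_density_finite[OF S] order.strict_trans1 by blast
  qed
  moreover have "D \<noteq> 0"
  proof
    assume "D = 0"
    hence "AE x in lborel. ennreal (f x) = 0"
      unfolding D_def f_def by (subst (asm) nn_integral_0_iff_AE) measurable
    hence "AE x in lborel :: (real^'p^'n) measure. False"
      by (rule eventually_mono) (use f_pos in \<open>auto simp: ennreal_eq_0_iff simp flip: not_less\<close>)
    hence "emeasure (lborel :: (real^'p^'n) measure) UNIV = 0"
      by (subst (asm) AE_iff_measurable[of UNIV]) auto
    thus False by simp
  qed
  moreover have "emeasure J {\<omega> \<in> space J. snd \<omega> = m} = D"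
    using emeasure_joint_law[OF S d \<open>length m = t\<close>, where P = "\<lambda>_. True" and \<mu> = \<mu> and \<tau> = \<tau>]
    by (simp add: J_def D_def f_def)
  moreover have "emeasure J {\<omega> \<in> space J. sel_pvalue \<Sigma> d \<tau> C1 C2 m (fst \<omega>) \<le> \<alpha> \<and> snd \<omega> = m} = ennreal \<alpha> * D"
    unfolding J_def D_def f_def
    by (subst emeasure_joint_law[OF S d \<open>length m = t\<close>], measurable)
      (rule nn_integral_sel_pvalue_le[OF S d \<open>valid_history m\<close> \<nu> \<mu> assms(11,12)])
  ultimately show ?thesis
    using \<open>0 \<le> \<alpha>\<close> unfolding cond_prob_def J_def[symmetric] measure_def
    by (simp add: enn2real_mult enn2real_eq_0_iff)
qed

end
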